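(* Let $\mathbb{S}^1=\mathbb{R}/2\pi\mathbb{Z}$, let $T>0$, let $\phi$ and $f_0$ satisfy assumptions (A1) and (A2) of the context on $\mathbb{S}^1$, and let $f_t(x)$, $t\in[0,T]$, be the corresponding solution of $$\partial_t f_t(x)+\partial_x\left(f_t(x)\int_0^{2\pi}\phi(x,y)f_t(y)\,\mathrm{d}y\right)=0\ \text{ on }\mathbb{S}^1,\qquad f_t|_{t=0}=f_0,$$ with the regularity stated in the context. Assume that $f_t(x)>0$ for a.e. $(t,x)\in[0,T]\times\mathbb{S}^1$. Fix $a\in[0,T]$, set $$C(t)=\int_a^t f_s(0)\int_0^{2\pi}\phi(0,y)f_s(y)\,\mathrm{d}y\,\mathrm{d}s,$$ and define, for $\xi\in[0,1]$, $$\tilde x(t,\xi)=\tilde x_t(\xi):=F_t^{-1}\big(\xi+C(t)\big)\in\mathbb{S}^1,$$ where $F_t^{-1}$ is the inverse of the circular cumulative distribution function $F_t$ of $f_t$. Then $$\partial_t\tilde x(t,\xi)=\int_0^1\phi\big(\tilde x(t,\xi),\tilde x(t,z)\big)\,\mathrm{d}z\qquad\text{for a.e. }t\in[0,T].$$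
   Context: Circular cumulative distribution function: for a probability density $f$ on $\mathbb{S}^1$, $F(x)=\int_0^x f(y)\,\mathrm{d}y$ for $x\in[0,2\pi]$, regarded as a map from $[0,2\pi]$ with endpoints identified ($=\mathbb{S}^1$) to $[0,1]$ with endpoints identified ($=\mathbb{R}/\mathbb{Z}$). $F_t$ is this function for $f_t$. Under the positivity assumption it is invertible, and $F_t^{-1}:\mathbb{R}/\mathbb{Z}\to\mathbb{S}^1$, so the argument $\xi+C(t)$ is read modulo $1$. Assumptions. (A1) For some integer $k\ge1$, the initial datum satisfies $f_0\in H^k(\mathbb{S}^1)\cap W^{1,1}(\mathbb{S}^1)$, $f_0\ge0$ a.e., and $\|f_0\|_{L^1}=1$. (A2) The interaction function has the form $\phi(x,y)=\Phi'(x-y)$ on $\mathbb{S}^1$ with $\Phi'\in L^2(\mathbb{S}^1)\cap L^\infty(\mathbb{S}^1)$, and there exist $p\in[1,2]$, $h\in L^p(\mathbb{S}^1)$ and $b\in\mathbb{R}$ such that $\Phi''=h+b\,\delta_0$ in the sense of distributions. Under (A1) and (A2), known theory provides for every $T>0$ a unique solution $f$ with $$f\in L^\infty([0,T];H^k(\mathbb{S}^1)\cap W^{1,1}(\mathbb{S}^1)),\quad \partial_t f\in L^\infty([0,T];H^{k-1}(\mathbb{S}^1)),\quad f\ge0\ \text{a.e.},\quad \|f_t\|_{L^1}=1\ \text{for a.e. } t.$$ The solution meant in the statement is this one, with its continuous representative. *)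

theory Defs
  imports "HOL-Analysis.Analysis"
begin

text \<open>
  The circle is \<open>\<real> / 2\<pi>\<int>\<close>. Functions on it are \<open>2\<pi>\<close>-periodic functions on \<open>\<real>\<close>, and a point of it
  is given by any real representative. Elements of \<open>L\<^sup>p\<close> are Lebesgue measurable representatives;
  integrals over the circle are integrals over \<open>[0, 2\<pi>]\<close>.
\<close>

definition circle_fun :: "(real \<Rightarrow> 'a) \<Rightarrow> bool" where
  "circle_fun f \<longleftrightarrow> (\<forall>x. f (x + 2 * pi) = f x)"

definition circle_Lp :: "real \<Rightarrow> (real \<Rightarrow> real) \<Rightarrow> bool" where
  "circle_Lp p f \<longleftrightarrow> circle_fun f \<and> f \<in> borel_measurable lebesgue \<and>
     set_integrable lebesgue {0..2 * pi} (\<lambda>x. \<bar>f x\<bar> powr p)"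

definition circle_Linf :: "(real \<Rightarrow> real) \<Rightarrow> bool" where
  "circle_Linf f \<longleftrightarrow> circle_fun f \<and> f \<in> borel_measurable lebesgue \<and>
     (\<exists>M. AE x in lebesgue. \<bar>f x\<bar> \<le> M)"

definition smooth :: "(real \<Rightarrow> real) \<Rightarrow> bool" where
  "smooth \<psi> \<longleftrightarrow> (\<forall>n x. (deriv ^^ n) \<psi> field_differentiable at x)"

definition circle_test_fun :: "(real \<Rightarrow> real) \<Rightarrow> bool" where
  "circle_test_fun \<psi> \<longleftrightarrow> smooth \<psi> \<and> circle_fun \<psi>"

definition circle_weak_deriv :: "nat \<Rightarrow> (real \<Rightarrow> real) \<Rightarrow> (real \<Rightarrow> real) \<Rightarrow> bool" where
  "circle_weak_deriv j f g \<longleftrightarrow> (\<forall>\<psi>. circle_test_fun \<psi> \<longrightarrow>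
     (LINT x:{0..2 * pi}|lebesgue. f x * (deriv ^^ j) \<psi> x)
       = (-1) ^ j * (LINT x:{0..2 * pi}|lebesgue. g x * \<psi> x))"

definition circle_sobolev :: "nat \<Rightarrow> real \<Rightarrow> (real \<Rightarrow> real) \<Rightarrow> bool" where
  "circle_sobolev m p f \<longleftrightarrow> circle_Lp p f \<and>
     (\<forall>j\<le>m. \<exists>g. circle_Lp p g \<and> circle_weak_deriv j f g)"

text \<open>Weak derivatives are unique almost everywhere, so the choice does not affect the norm.\<close>

definition circle_wderiv :: "nat \<Rightarrow> (real \<Rightarrow> real) \<Rightarrow> real \<Rightarrow> real" where
  "circle_wderiv j f = (SOME g. circle_Lp 1 g \<and> circle_weak_deriv j f g)"

definition circle_sobolev_norm :: "nat \<Rightarrow> real \<Rightarrow> (real \<Rightarrow> real) \<Rightarrow> real" where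
  "circle_sobolev_norm m p f =
     (\<Sum>j\<le>m. LINT x:{0..2 * pi}|lebesgue. \<bar>circle_wderiv j f x\<bar> powr p) powr (1 / p)"

abbreviation circle_H :: "nat \<Rightarrow> (real \<Rightarrow> real) \<Rightarrow> bool" where
  "circle_H m \<equiv> circle_sobolev m 2"

abbreviation circle_W11 :: "(real \<Rightarrow> real) \<Rightarrow> bool" where
  "circle_W11 \<equiv> circle_sobolev 1 1"

text \<open>
  \<open>L\<^sup>\<infinity>([0,T]; W\<^bsup>m,p\<^esup>)\<close>. The space \<open>W\<^bsup>m,p\<^esup>\<close> is separable for \<open>p < \<infinity>\<close>, so Bochner measurability of
  \<open>t \<mapsto> f t\<close> amounts to joint measurability of \<open>f\<close> up to the choice of representatives.
\<close>

definition Linf_sobolev ::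
  "real \<Rightarrow> nat \<Rightarrow> real \<Rightarrow> (real \<Rightarrow> real \<Rightarrow> real) \<Rightarrow> bool" where
  "Linf_sobolev T m p f \<longleftrightarrow>
     (\<lambda>(t, x). f t x) \<in> borel_measurable (lebesgue_on ({0..T} \<times> UNIV)) \<and>
     (\<exists>M. AE t in lebesgue_on {0..T}.
        circle_sobolev m p (f t) \<and> circle_sobolev_norm m p (f t) \<le> M)"

text \<open>
  \<open>g\<close> is the weak derivative of the Bochner function \<open>t \<mapsto> f t\<close>: the integrals over \<open>t\<close> are elements
  of a space of functions of \<open>x\<close>, whose equality is equality almost everywhere.
\<close>

definition weak_time_deriv ::
  "real \<Rightarrow> (real \<Rightarrow> real \<Rightarrow> real) \<Rightarrow> (real \<Rightarrow> real \<Rightarrow> real) \<Rightarrow> bool" where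
  "weak_time_deriv T f g \<longleftrightarrow>
     (\<forall>\<eta>. smooth \<eta> \<and> compact (closure {t. \<eta> t \<noteq> 0}) \<and> closure {t. \<eta> t \<noteq> 0} \<subseteq> {0<..<T} \<longrightarrow>
       (AE x in lebesgue. (LINT t:{0..T}|lebesgue. deriv \<eta> t * f t x)
          = - (LINT t:{0..T}|lebesgue. \<eta> t * g t x)))"

definition initial_datum_assumption :: "nat \<Rightarrow> (real \<Rightarrow> real) \<Rightarrow> bool" where
  "initial_datum_assumption k f0 \<longleftrightarrow> k \<ge> 1 \<and> circle_H k f0 \<and> circle_W11 f0 \<and>
     (AE x in lebesgue. f0 x \<ge> 0) \<and> (LINT x:{0..2 * pi}|lebesgue. \<bar>f0 x\<bar>) = 1"

text \<open>\<open>\<Phi>'\<close> and \<open>h\<close> are functions in their own right; the integral identity is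
  \<open>\<Phi>'' = h + b \<delta>\<^sub>0\<close> in the sense of distributions on the circle.\<close>

definition interaction_assumption :: "(real \<Rightarrow> real \<Rightarrow> real) \<Rightarrow> bool" where
  "interaction_assumption \<phi> \<longleftrightarrow>
     (\<exists>\<Phi>'. (\<forall>x y. \<phi> x y = \<Phi>' (x - y)) \<and> circle_Lp 2 \<Phi>' \<and> circle_Linf \<Phi>' \<and>
       (\<exists>p\<in>{1..2}. \<exists>h b. circle_Lp p h \<and>
         (\<forall>\<psi>. circle_test_fun \<psi> \<longrightarrow>
            - (LINT x:{0..2 * pi}|lebesgue. \<Phi>' x * deriv \<psi> x)
              = (LINT x:{0..2 * pi}|lebesgue. h x * \<psi> x) + b * \<psi> 0)))"

definition velocity :: "(real \<Rightarrow> real \<Rightarrow> real) \<Rightarrow> (real \<Rightarrow> real) \<Rightarrow> real \<Rightarrow> real" where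
  "velocity \<phi> \<rho> x = (LINT y:{0..2 * pi}|lebesgue. \<phi> x y * \<rho> y)"

text \<open>
  The solution is represented by its continuous representative. Since \<open>\<partial>\<^sub>t f\<close> is a function with
  values in \<open>L\<^sup>2\<close>, the equation is an identity in \<open>L\<^sup>2\<close> for almost every \<open>t\<close>: the weak derivative of
  \<open>f\<^sub>t u\<^sub>t\<close> in \<open>x\<close>, with \<open>u\<^sub>t\<close> the velocity, is \<open>- \<partial>\<^sub>t f\<^sub>t\<close>.
\<close>

definition is_solution ::
  "real \<Rightarrow> nat \<Rightarrow> (real \<Rightarrow> real \<Rightarrow> real) \<Rightarrow> (real \<Rightarrow> real) \<Rightarrow> (real \<Rightarrow> real \<Rightarrow> real) \<Rightarrow> bool" where
  "is_solution T k \<phi> f0 f \<longleftrightarrow>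
     (\<forall>t\<in>{0..T}. circle_fun (f t)) \<and>
     continuous_on ({0..T} \<times> UNIV) (\<lambda>(t, x). f t x) \<and>
     Linf_sobolev T k 2 f \<and> Linf_sobolev T 1 1 f \<and>
     (AE z in lebesgue_on ({0..T} \<times> UNIV). f (fst z) (snd z) \<ge> 0) \<and>
     (AE t in lebesgue_on {0..T}. (LINT x:{0..2 * pi}|lebesgue. \<bar>f t x\<bar>) = 1) \<and>
     (AE x in lebesgue. f 0 x = f0 x) \<and>
     (\<exists>f'. Linf_sobolev T (k - 1) 2 f' \<and> weak_time_deriv T f f' \<and>
        (AE t in lebesgue_on {0..T}.
           circle_weak_deriv 1 (\<lambda>x. f t x * velocity \<phi> (f t) x) (\<lambda>x. - f' t x)))"

definition circ_cdf :: "(real \<Rightarrow> real) \<Rightarrow> real \<Rightarrow> real" where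
  "circ_cdf \<rho> x = (LINT y:{0..x}|lebesgue. \<rho> y)"

text \<open>
  The inverse \<open>\<real>/\<int> \<rightarrow> \<real>/2\<pi>\<int>\<close> of the circular distribution function: the argument is reduced modulo
  \<open>1\<close> to \<open>[0, 1)\<close>, and the value is the representative in \<open>[0, 2\<pi>)\<close>.
\<close>

definition circ_cdf_inv :: "(real \<Rightarrow> real) \<Rightarrow> real \<Rightarrow> real" where
  "circ_cdf_inv \<rho> \<eta> = the_inv_into {0..<2 * pi} (circ_cdf \<rho>) (frac \<eta>)"

text \<open>
  Derivative of a curve in the circle given by representatives: the derivative of a lift, which need
  not be continuous away from \<open>t\<close>. Two lifts differentiable at \<open>t\<close> differ by a constant near \<open>t\<close>.
  Without this, jumps of the representative between \<open>0\<close> and \<open>2\<pi>\<close> would destroy differentiability.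
\<close>

definition has_circle_derivative_within :: "(real \<Rightarrow> real) \<Rightarrow> real \<Rightarrow> real \<Rightarrow> real set \<Rightarrow> bool" where
  "has_circle_derivative_within \<gamma> v t S \<longleftrightarrow>
     (\<exists>g. (\<forall>s\<in>S. \<exists>n::int. g s = \<gamma> s + 2 * pi * of_int n) \<and>
          (g has_real_derivative v) (at t within S))"

end

theory Submission imports Defs begin

text \<open>
  Let \<open>u\<^sub>t\<close> be the velocity of \<open>f\<^sub>t\<close>. Testing the equation against smooth functions of \<open>t\<close> and of \<open>x\<close>
  shows that \<open>G\<^sub>t(x) = F\<^sub>t(x) - C(t)\<close> is continuously differentiable, with \<open>\<partial>\<^sub>x G = f\<close> and
  \<open>\<partial>\<^sub>t G = - f u\<close>; the choice of \<open>C\<close> cancels the flux through \<open>x = 0\<close>. A lift of \<open>t \<mapsto> x\<^sub>t(\<xi>)\<close> is the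
  level curve \<open>G\<^sub>t(\<gamma>(t)) = \<xi>\<close>. Along a line of slope \<open>v\<close> the derivative of \<open>G\<close> is \<open>f (v - u)\<close>, so lines
  whose slope is slightly larger or smaller than \<open>u\<close> are barriers for \<open>\<gamma>\<close>, and \<open>\<gamma>' = u\<close> even where \<open>f\<close>
  vanishes; lines whose slope exceeds \<open>sup |u|\<close> show that \<open>F\<^sub>t\<close> is strictly increasing for every \<open>t\<close>, since
  a vacuum could only fill up at finite speed. Substituting \<open>z = G\<^sub>t(y)\<close> turns
  \<open>\<integral> \<phi>(x, x\<^sub>t(z)) dz\<close> into \<open>u\<^sub>t(x)\<close>.
\<close>

section \<open>Smooth functions\<close>

text \<open>The equation is given only weakly: \<open>f'\<close> has no pointwise values, and
  \<open>f\<close> may have zeros, so neither can the equation be used pointwise nor the inverse of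
  \<open>F t\<close> be differentiated directly. Passing to \<open>G\<close>, an integral in time,
  avoids both. For a fixed test function of \<open>x\<close>, testing in \<open>t\<close> gives an
  identity at every time, since both sides are continuous; only then is the test function of
  \<open>x\<close> removed. The partial derivatives \<open>f\<close> and \<open>- f u\<close> of
  \<open>G\<close> are continuous because \<open>u\<close> is a convolution of a bounded kernel with
  a continuous density. The curves are level sets of \<open>G\<close>, not trajectories of
  \<open>u\<close>, so no uniqueness for the characteristic equation enters. Positivity almost
  everywhere is used in one form: every box in space-time contains a point with
  \<open>f > 0\<close>. With continuity this gives \<open>f \<ge> 0\<close> everywhere, and it
  contradicts the persistence of a vacuum. The distribution function is continued to the whole line
  by a primitive of the periodic density, which gains mass 1 per period; the integer part lost in
  reducing \<open>\<xi> + C(t)\<close> modulo 1 reappears as full turns of the lift.\<close>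

primrec times_diff :: "nat \<Rightarrow> (real \<Rightarrow> real) \<Rightarrow> bool" where
  "times_diff 0 f \<longleftrightarrow> True"
| "times_diff (Suc n) f \<longleftrightarrow>
     (\<exists>f'. (\<forall>x. (f has_real_derivative f' x) (at x)) \<and> times_diff n f')"

lemma times_diff_SucI:
  assumes "\<And>x. (f has_real_derivative f' x) (at x)" "times_diff n f'"
  shows "times_diff (Suc n) f"
  using assms by auto

lemma times_diff_Suc_imp: "times_diff (Suc n) f \<Longrightarrow> times_diff n f"
proof (induction n arbitrary: f)
  case (Suc n)
  then obtain f' where "\<forall>x. (f has_real_derivative f' x) (at x)" "times_diff (Suc n) f'"
    by (meson times_diff.simps(2))
  then show ?case
    using Suc.IH by auto
qed simp

lemma times_diff_iterated_deriv:
  "times_diff (Suc n) f \<Longrightarrow> (deriv ^^ n) f field_differentiable at x"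
proof (induction n arbitrary: f)
  case 0
  then show ?case by (auto simp: field_differentiable_def)
next
  case (Suc n)
  then obtain f' where f': "\<forall>x. (f has_real_derivative f' x) (at x)" "times_diff (Suc n) f'"
    by (meson times_diff.simps(2))
  then have "deriv f = f'"
    by (intro ext DERIV_imp_deriv) blast
  then show ?case
    using Suc.IH[OF f'(2)] by (simp only: funpow_Suc_right comp_apply)
qed

lemma smooth_imp_deriv: "smooth f \<Longrightarrow> (f has_real_derivative deriv f x) (at x)"
  using DERIV_deriv_iff_field_differentiable[of f x] funpow_0[of deriv f]
  unfolding smooth_def by metis

lemma smooth_deriv: "smooth f \<Longrightarrow> smooth (deriv f)"
  unfolding smooth_def by (metis comp_apply funpow_Suc_right)

text \<open>\<open>times_diff\<close> quantifies over the derivative as a function instead of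
  iterating \<open>deriv\<close>, so that closure under sums, products and composition follows by
  induction from the differentiation rules.\<close>

lemma smooth_iff_times_diff: "smooth f \<longleftrightarrow> (\<forall>n. times_diff n f)"
proof
  show "\<forall>n. times_diff n f" if "smooth f"
  proof
    show "times_diff n f" for n
      using that
    proof (induction n arbitrary: f)
      case (Suc n)
      then show ?case
        using smooth_imp_deriv smooth_deriv times_diff_SucI by blast
    qed simp
  qed
next
  show "smooth f" if "\<forall>n. times_diff n f"
    unfolding smooth_def using that times_diff_iterated_deriv by blast
qed

section \<open>Closure properties and standard smooth functions\<close>

lemma times_diff_const: "times_diff n (\<lambda>_. c)"
proof (induction n arbitrary: c)
  case (Suc n)
  show ?case by (rule times_diff_SucI[OF _ Suc[of 0]]) (auto intro!: derivative_eq_intros)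
qed simp

lemma times_diff_ident: "times_diff n (\<lambda>x. x)"
  by (cases n) (auto intro!: exI[of _ "\<lambda>_. 1"] derivative_eq_intros times_diff_const)

lemma times_diff_add:
  "times_diff n f \<Longrightarrow> times_diff n g \<Longrightarrow> times_diff n (\<lambda>x. f x + g x)"
proof (induction n arbitrary: f g)
  case (Suc n)
  then obtain f' g' where *: "\<forall>x. (f has_real_derivative f' x) (at x)" "times_diff n f'"
    "\<forall>x. (g has_real_derivative g' x) (at x)" "times_diff n g'"
    unfolding times_diff.simps by blast
  show ?case
  proof (rule times_diff_SucI)
    show "((\<lambda>x. f x + g x) has_real_derivative f' x + g' x) (at x)" for x
      using * by (intro DERIV_add) blast+
    show "times_diff n (\<lambda>x. f' x + g' x)"
      using * by (intro Suc.IH)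
  qed
qed simp

lemma times_diff_mult:
  "times_diff n f \<Longrightarrow> times_diff n g \<Longrightarrow> times_diff n (\<lambda>x. f x * g x)"
proof (induction n arbitrary: f g)
  case (Suc n)
  then obtain f' g' where *: "\<forall>x. (f has_real_derivative f' x) (at x)" "times_diff n f'"
    "\<forall>x. (g has_real_derivative g' x) (at x)" "times_diff n g'"
    unfolding times_diff.simps by blast
  have "times_diff n f" "times_diff n g"
    using Suc.prems times_diff_Suc_imp by blast+
  note fg = this
  show ?case
  proof (rule times_diff_SucI)
    show "((\<lambda>x. f x * g x) has_real_derivative f' x * g x + g' x * f x) (at x)" for x
      using * by (intro DERIV_mult) blast+
    show "times_diff n (\<lambda>x. f' x * g x + g' x * f x)"
      using * fg by (intro times_diff_add Suc.IH)
  qed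
qed simp

lemma times_diff_compose:
  "times_diff n g \<Longrightarrow> times_diff n f \<Longrightarrow> times_diff n (\<lambda>x. g (f x))"
proof (induction n arbitrary: f g)
  case (Suc n)
  then obtain f' g' where *: "\<forall>x. (f has_real_derivative f' x) (at x)" "times_diff n f'"
    "\<forall>x. (g has_real_derivative g' x) (at x)" "times_diff n g'"
    unfolding times_diff.simps by blast
  have f: "times_diff n f"
    using Suc.prems times_diff_Suc_imp by blast
  show ?case
  proof (rule times_diff_SucI)
    show "((\<lambda>x. g (f x)) has_real_derivative g' (f x) * f' x) (at x)" for x
      by (rule DERIV_chain2[OF *(3)[rule_format] *(1)[rule_format]])
    show "times_diff n (\<lambda>x. g' (f x) * f' x)"
      by (intro times_diff_mult Suc.IH[OF *(4) f] *(2))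
  qed
qed simp

lemma times_diff_sin_cos: "times_diff n sin \<and> times_diff n cos"
proof (induction n)
  case (Suc n)
  have "times_diff n (\<lambda>x. (-1) * sin x)"
    using Suc by (intro times_diff_mult times_diff_const) auto
  with Suc show ?case
    using times_diff_SucI[OF DERIV_sin] times_diff_SucI[of cos "\<lambda>x. - sin x"] DERIV_cos by simp
qed simp

text \<open>For \<open>m = 0\<close> this is the classical flat function. The powers of
  \<open>1 / x\<close> are what differentiation produces, so the family is closed under derivatives
  up to linear combinations.\<close>

definition flat_exp :: "nat \<Rightarrow> real \<Rightarrow> real" where
  "flat_exp m x = (if x > 0 then (1 / x) ^ m * exp (- (1 / x)) else 0)"

lemma flat_exp_tendsto_0: "(flat_exp m \<longlongrightarrow> 0) (at_right 0)"
proof -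
  have "((\<lambda>x::real. x ^ m / exp x) \<longlongrightarrow> 0) at_top"
    by (rule tendsto_power_div_exp_0)
  then have "((\<lambda>x::real. inverse x ^ m / exp (inverse x)) \<longlongrightarrow> 0) (at_right 0)"
    by (rule filterlim_compose[OF _ filterlim_inverse_at_top_right])
  moreover have "\<forall>\<^sub>F x in at_right (0::real). inverse x ^ m / exp (inverse x) = flat_exp m x"
    by (rule eventually_mono[OF eventually_at_right_less[of 0]])
      (auto simp: flat_exp_def field_simps exp_minus)
  ultimately show ?thesis
    by (rule Lim_transform_eventually)
qed

lemma has_derivative_flat_exp:
  "(flat_exp m has_real_derivative flat_exp (m + 2) x - real m * flat_exp (m + 1) x) (at x)"
proof -
  consider "x > 0" | "x < 0" | "x = 0" by linarith
  then show ?thesis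
  proof cases
    case 1
    have d: "((\<lambda>x. 1 / x) has_real_derivative - (1 / x\<^sup>2)) (at x)"
      using DERIV_inverse[of x UNIV] 1 by (simp add: divide_inverse power2_eq_square)
    have "((\<lambda>x. (1 / x) ^ m * exp (- (1 / x))) has_real_derivative
        (real m * (- (1 / x\<^sup>2) * (1 / x) ^ (m - Suc 0))) * exp (- (1 / x)) +
        (exp (- (1 / x)) * - (- (1 / x\<^sup>2))) * (1 / x) ^ m) (at x)"
      by (rule DERIV_mult[OF DERIV_power[OF d] DERIV_chain2[OF DERIV_exp DERIV_minus[OF d]]])
    also have "(real m * (- (1 / x\<^sup>2) * (1 / x) ^ (m - Suc 0))) * exp (- (1 / x)) +
        (exp (- (1 / x)) * - (- (1 / x\<^sup>2))) * (1 / x) ^ m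
        = flat_exp (m + 2) x - real m * flat_exp (m + 1) x"
      \<comment> \<open>The exponent \<open>m - Suc 0\<close> is truncated at \<open>m = 0\<close>,
        where the factor \<open>real m\<close> removes the term.\<close>
      using 1 by (cases m) (simp_all add: flat_exp_def power2_eq_square algebra_simps)
    finally have "((\<lambda>x. (1 / x) ^ m * exp (- (1 / x))) has_real_derivative
        flat_exp (m + 2) x - real m * flat_exp (m + 1) x) (at x)" .
    then show ?thesis
      by (rule has_field_derivative_transform_within_open[of _ _ _ "{0<..}"])
        (use 1 in \<open>auto simp: flat_exp_def\<close>)
  next
    case 2
    have "((\<lambda>x. 0) has_real_derivative flat_exp (m + 2) x - real m * flat_exp (m + 1) x) (at x)"
      using 2 by (simp add: flat_exp_def)
    then show ?thesis
      by (rule has_field_derivative_transform_within_open[of _ _ _ "{..<0}"])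
        (use 2 in \<open>auto simp: flat_exp_def\<close>)
  next
    case 3
    have "((\<lambda>y. (flat_exp m y - flat_exp m 0) / (y - 0)) \<longlongrightarrow> 0) (at_left 0)"
      by (rule Lim_transform_eventually[OF tendsto_const])
        (rule eventually_mono[OF eventually_at_left_real[of "-1" 0]], auto simp: flat_exp_def)
    \<comment> \<open>To the right of 0 the difference quotient is \<open>flat_exp (Suc m)\<close>,
      so the limit already known applies.\<close>
    moreover have "((\<lambda>y. (flat_exp m y - flat_exp m 0) / (y - 0)) \<longlongrightarrow> 0) (at_right 0)"
      by (rule Lim_transform_eventually[OF flat_exp_tendsto_0[of "Suc m"]])
        (rule eventually_mono[OF eventually_at_right_less[of 0]], auto simp: flat_exp_def)
    ultimately have "(flat_exp m has_real_derivative 0) (at 0)"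
      unfolding has_field_derivative_iff by (rule filterlim_split_at)
    then show ?thesis
      unfolding 3 by (simp add: flat_exp_def)
  qed
qed

lemma times_diff_flat_exp: "times_diff n (flat_exp m)"
proof (induction n arbitrary: m)
  case (Suc n)
  have "times_diff n (\<lambda>x. flat_exp (m + 2) x + (- real m) * flat_exp (m + 1) x)"
    by (intro times_diff_add times_diff_mult times_diff_const Suc)
  then show ?case
    using has_derivative_flat_exp[of m] by (intro times_diff_SucI) auto
qed simp

lemma smooth_const: "smooth (\<lambda>_. c)"
  and smooth_ident: "smooth (\<lambda>x. x)"
  and smooth_add: "smooth f \<Longrightarrow> smooth g \<Longrightarrow> smooth (\<lambda>x. f x + g x)"
  and smooth_mult: "smooth f \<Longrightarrow> smooth g \<Longrightarrow> smooth (\<lambda>x. f x * g x)"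
  and smooth_compose: "smooth g \<Longrightarrow> smooth f \<Longrightarrow> smooth (\<lambda>x. g (f x))"
  and smooth_cos: "smooth cos"
  and smooth_flat_exp: "smooth (flat_exp m)"
  by (simp_all add: smooth_iff_times_diff times_diff_const times_diff_ident times_diff_add
      times_diff_mult times_diff_compose times_diff_sin_cos times_diff_flat_exp)

lemma smooth_diff: "smooth f \<Longrightarrow> smooth g \<Longrightarrow> smooth (\<lambda>x. f x - g x)"
  using smooth_add[OF _ smooth_mult[OF smooth_const[of "-1"]], of f g] by simp

lemma smooth_primitive:
  assumes "\<And>x. (g has_real_derivative f x) (at x)" "smooth f"
  shows "smooth g"
  unfolding smooth_iff_times_diff
proof
  show "times_diff n g" for n
    using assms times_diff_SucI smooth_iff_times_diff times_diff_Suc_imp by blast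
qed

lemma smooth_imp_continuous_on: "smooth f \<Longrightarrow> continuous_on S f"
  using smooth_imp_deriv by (meson DERIV_isCont continuous_at_imp_continuous_on)

text \<open>Smooth approximations of the indicator of the set where \<open>g\<close> is positive:
  there the value is \<open>exp (- 1 / ((n + 1) g))\<close>, which increases to 1. The factor is
  \<open>Suc n\<close> so that \<open>bump g 0\<close> is already positive on that set.\<close>

definition bump :: "(real \<Rightarrow> real) \<Rightarrow> nat \<Rightarrow> real \<Rightarrow> real" where
  "bump g n x = flat_exp 0 (real (Suc n) * g x)"

lemma smooth_bump: "smooth g \<Longrightarrow> smooth (bump g n)"
  unfolding bump_def by (intro smooth_compose[OF smooth_flat_exp] smooth_mult smooth_const)

lemma bump_bounds: "0 \<le> bump g n x" "bump g n x \<le> 1"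
  by (auto simp: bump_def flat_exp_def)

lemma bump_pos_iff: "bump g n x > 0 \<longleftrightarrow> g x > 0"
  and bump_eq_0: "g x \<le> 0 \<Longrightarrow> bump g n x = 0"
  by (auto simp: bump_def flat_exp_def zero_less_mult_iff mult_le_0_iff)

lemma bump_tendsto: "(\<lambda>n. bump g n x) \<longlonglongrightarrow> indicator {x. g x > 0} x"
proof (cases "g x > 0")
  case True
  have "(\<lambda>n. exp (- (inverse (real (Suc n)) * inverse (g x)))) \<longlonglongrightarrow> exp (- (0 * inverse (g x)))"
    by (intro tendsto_intros LIMSEQ_inverse_real_of_nat)
  then show ?thesis
    using True by (simp add: bump_def flat_exp_def divide_inverse mult.commute)
next
  case False
  then show ?thesis
    by (simp add: bump_eq_0)
qed

section \<open>Fundamental lemmas of the calculus of variations\<close>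

lemma AE_neq_lebesgue: "AE x in lebesgue. x \<noteq> (c::real)"
proof -
  have "{c} \<in> null_sets lebesgue"
    by simp
  then show ?thesis
    by (metis (mono_tags, lifting) AE_not_in eventually_mono singletonI)
qed

lemma bump_integral_tendsto:
  fixes h :: "real \<Rightarrow> real"
  assumes h: "set_integrable lebesgue S h" and g: "smooth g"
  shows "(\<lambda>n. LINT x:S|lebesgue. h x * bump g n x)
    \<longlonglongrightarrow> (LINT x:S|lebesgue. h x * indicator {x. g x > 0} x)"
  unfolding set_lebesgue_integral_def
proof (rule integral_dominated_convergence)
  have g_cont: "continuous_on UNIV g"
    by (rule smooth_imp_continuous_on[OF g])
  have open_pos: "{x. g x > 0} \<in> sets lebesgue"
    using open_Collect_less[OF continuous_on_const g_cont] by auto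
  have hS: "(\<lambda>x. indicator S x * h x) \<in> borel_measurable lebesgue"
    using h by (auto simp: set_integrable_def)
  have "(\<lambda>x. (indicator S x * h x) * indicator {x. g x > 0} x) \<in> borel_measurable lebesgue"
    by (intro borel_measurable_times hS borel_measurable_indicator open_pos)
  then show "(\<lambda>x. indicator S x *\<^sub>R (h x * indicator {x. g x > 0} x)) \<in> borel_measurable lebesgue"
    by (simp add: mult.assoc)
  have "bump g n \<in> borel_measurable lebesgue" for n
    using smooth_imp_continuous_on[OF smooth_bump[OF g], of UNIV]
    by (simp add: borel_measurable_continuous_onI measurable_completion)
  then have "(\<lambda>x. (indicator S x * h x) * bump g n x) \<in> borel_measurable lebesgue" for n
    by (intro borel_measurable_times hS)
  then show "(\<lambda>x. indicator S x *\<^sub>R (h x * bump g n x)) \<in> borel_measurable lebesgue" for n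
    by (simp add: mult.assoc)
  show "integrable lebesgue (\<lambda>x. \<bar>indicator S x * h x\<bar>)"
    using h by (auto simp: set_integrable_def)
  show "AE x in lebesgue. (\<lambda>n. indicator S x *\<^sub>R (h x * bump g n x))
      \<longlonglongrightarrow> indicator S x *\<^sub>R (h x * indicator {x. g x > 0} x)"
    by (intro AE_I2 tendsto_intros bump_tendsto)
  show "AE x in lebesgue. norm (indicator S x *\<^sub>R (h x * bump g n x)) \<le> \<bar>indicator S x * h x\<bar>" for n
    using bump_bounds[of g n] by (intro AE_I2) (auto simp: abs_mult indicator_def intro!: mult_left_le)
qed

text \<open>The positive and negative parts of \<open>h\<close>, cut off outside the interval, are
  densities of two finite measures. They agree on all half-lines, which determine such a measure, so
  the two densities agree almost everywhere.\<close>

lemma AE_eq_0_if_interval_integrals_eq_0: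
  fixes h :: "real \<Rightarrow> real"
  assumes h: "set_integrable lebesgue {a..b} h"
    and zero: "\<And>c d. a \<le> c \<Longrightarrow> c < d \<Longrightarrow> d \<le> b \<Longrightarrow> (LINT x:{c..d}|lebesgue. h x) = 0"
  shows "AE x in lebesgue. x \<in> {a..b} \<longrightarrow> h x = 0"
proof -
  let ?H = "\<lambda>x. indicator {a..b} x * h x"
  have H: "integrable lebesgue ?H"
    using h by (simp add: set_integrable_def)
  obtain q where q[measurable]: "q \<in> borel_measurable lborel"
    and Hq: "AE x in lborel. ?H x = q x"
    using completion_ex_borel_measurable_real[of ?H lborel] H by auto
  have Hq': "AE x in lebesgue. ?H x = q x"
    by (rule AE_completion[OF Hq])
  have "integrable lebesgue q"
    using integrable_cong_AE_imp[OF H _ Hq'] measurable_completion[OF q] by blast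
  then have q_int: "integrable lborel q"
    by (simp add: integrable_completion)
  have tail: "(LINT x:{y<..}|lborel. q x) = 0" for y
  proof -
    have "(LINT x:{y<..}|lborel. q x) = (LINT x:{y<..}|lebesgue. q x)"
      unfolding set_lebesgue_integral_def by (subst integral_completion) auto
    also have "\<dots> = (LINT x:{y<..}|lebesgue. ?H x)"
      unfolding set_lebesgue_integral_def
    proof (intro integral_cong_AE)
      show "(\<lambda>x. indicator {y<..} x *\<^sub>R q x) \<in> borel_measurable lebesgue"
        by (intro borel_measurable_scaleR borel_measurable_indicator measurable_completion[OF q]) auto
      show "(\<lambda>x. indicator {y<..} x *\<^sub>R ?H x) \<in> borel_measurable lebesgue"
        by (intro borel_measurable_scaleR borel_measurable_indicator borel_measurable_integrable[OF H]) auto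
      show "AE x in lebesgue. indicator {y<..} x *\<^sub>R q x = indicator {y<..} x *\<^sub>R ?H x"
        using Hq' by eventually_elim simp
    qed
    also have "\<dots> = (LINT x:{max a y..b}|lebesgue. h x)"
      unfolding set_lebesgue_integral_def
    proof (intro integral_cong_AE)
      show "(\<lambda>x. indicator {y<..} x *\<^sub>R ?H x) \<in> borel_measurable lebesgue"
        by (intro borel_measurable_scaleR borel_measurable_indicator borel_measurable_integrable[OF H]) auto
      have "(\<lambda>x. indicator {max a y..b} x *\<^sub>R ?H x) \<in> borel_measurable lebesgue"
        by (intro borel_measurable_scaleR borel_measurable_indicator borel_measurable_integrable[OF H]) auto
      also have "(\<lambda>x. indicator {max a y..b} x *\<^sub>R ?H x) = (\<lambda>x. indicator {max a y..b} x *\<^sub>R h x)"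
        by (auto simp: indicator_def)
      finally show "\<dots> \<in> borel_measurable lebesgue" .
      have "AE x in lebesgue. x \<noteq> y"
        by (rule AE_neq_lebesgue)
      then show "AE x in lebesgue. indicator {y<..} x *\<^sub>R ?H x = indicator {max a y..b} x *\<^sub>R h x"
        by eventually_elim (auto simp: indicator_def)
    qed
    also have "\<dots> = 0"
    proof (cases "max a y < b")
      case True
      then show ?thesis by (intro zero) auto
    next
      case False
      then have "{max a y..b} \<subseteq> {b}" by auto
      have "AE x in lebesgue. x \<noteq> b"
        by (rule AE_neq_lebesgue)
      then show ?thesis
        unfolding set_lebesgue_integral_def
        by (intro integral_eq_zero_AE, eventually_elim)
          (use \<open>{max a y..b} \<subseteq> {b}\<close> in \<open>auto simp: indicator_def\<close>)
    qed
    finally show ?thesis .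
  qed
  \<comment> \<open>Since \<open>ennreal\<close> sends negative numbers to 0, these two densities
    are the positive and the negative part of \<open>q\<close>. Their equality forces
    \<open>q = 0\<close>, as at each point one of them vanishes.\<close>
  have "density lborel (\<lambda>x. ennreal (q x)) = density lborel (\<lambda>x. ennreal (- q x))"
  proof (rule measure_eqI_lessThan)
    have em: "emeasure (density lborel (\<lambda>x. ennreal (r x))) {y<..}
        = ennreal (LINT x:{y<..}|lborel. max 0 (r x))"
      if "integrable lborel r" for r :: "real \<Rightarrow> real" and y :: real
    proof -
      have "emeasure (density lborel (\<lambda>x. ennreal (r x))) {y<..}
          = (\<integral>\<^sup>+x. ennreal (indicator {y<..} x * max 0 (r x)) \<partial>lborel)"
        using that by (subst emeasure_density)
          (auto intro!: nn_integral_cong simp: indicator_def ennreal_neg max_def)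
      also have "\<dots> = ennreal (LINT x:{y<..}|lborel. max 0 (r x))"
        unfolding set_lebesgue_integral_def
        using that integrable_mult_indicator[of "{y<..}" lborel "\<lambda>x. max 0 (r x)"]
        by (subst nn_integral_eq_integral) auto
      finally show ?thesis .
    qed
    have q_neg: "integrable lborel (\<lambda>x. - q x)"
      using q_int by simp
    have split: "(LINT x:{y<..}|lborel. max 0 (q x)) - (LINT x:{y<..}|lborel. max 0 (- q x))
        = (LINT x:{y<..}|lborel. q x)" for y
    proof -
      have "set_integrable lborel {y<..} (\<lambda>x. max 0 (q x))"
        "set_integrable lborel {y<..} (\<lambda>x. max 0 (- q x))"
        unfolding set_integrable_def using q_int
          integrable_mult_indicator[of "{y<..}" lborel "\<lambda>x. max 0 (q x)"]
          integrable_mult_indicator[of "{y<..}" lborel "\<lambda>x. max 0 (- q x)"] by auto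
      from set_integral_diff(2)[OF this]
      have "(LINT x:{y<..}|lborel. max 0 (q x)) - (LINT x:{y<..}|lborel. max 0 (- q x))
        = (LINT x:{y<..}|lborel. max 0 (q x) - max 0 (- q x))" ..
      also have "(\<lambda>x. max 0 (q x) - max 0 (- q x)) = q"
        by (auto simp: max_def)
      finally show ?thesis .
    qed
    show "emeasure (density lborel (\<lambda>x. ennreal (q x))) {y<..} < \<infinity>" for y
      by (simp add: em[OF q_int])
    show "emeasure (density lborel (\<lambda>x. ennreal (q x))) {y<..}
        = emeasure (density lborel (\<lambda>x. ennreal (- q x))) {y<..}" for y
      unfolding em[OF q_int] em[OF q_neg] using split[of y] tail[of y] by simp
  qed auto
  then have "AE x in lborel. ennreal (q x) = ennreal (- q x)"
    by (rule sigma_finite_measure.density_unique[OF sigma_finite_lborel, rotated 2]) auto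
  then have "AE x in lborel. q x = 0"
    by eventually_elim (metis ennreal_neg ennreal_eq_0_iff linear neg_le_0_iff_le order_antisym)
  then have "AE x in lebesgue. q x = 0"
    by (rule AE_completion)
  with Hq' show ?thesis
    by eventually_elim (auto simp: indicator_def)
qed

lemma continuous_AE_eq_0_imp_eq_0:
  fixes h :: "real \<Rightarrow> real"
  assumes "continuous_on {a..b} h" "a < b" "AE x in lebesgue. x \<in> {a..b} \<longrightarrow> h x = 0" "x \<in> {a..b}"
  shows "h x = 0"
proof -
  obtain N where "N \<in> null_sets lebesgue" "{x \<in> space lebesgue. \<not> (x \<in> {a..b} \<longrightarrow> h x = 0)} \<subseteq> N"
    using assms(3) unfolding eventually_ae_filter by blast
  then have "negligible {x \<in> {a..b}. \<bar>h x\<bar> \<noteq> 0}"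
    by (intro negligible_subset[of N "{x \<in> {a..b}. \<bar>h x\<bar> \<noteq> 0}"]) (auto simp: negligible_iff_null_sets)
  then have "integral {a..b} (\<lambda>x. \<bar>h x\<bar>) = integral {a..b} (\<lambda>_. 0)"
    by (intro integral_spike) auto
  moreover have "continuous_on {a..b} (\<lambda>x. \<bar>h x\<bar>)"
    by (intro continuous_on_rabs assms)
  ultimately show ?thesis
    using integral_eq_0_iff[of a b "\<lambda>x. \<bar>h x\<bar>"] assms(2,4) by simp
qed

section \<open>Primitives, and test functions on the circle\<close>

lemma LINT_continuous:
  fixes g :: "real \<Rightarrow> real"
  assumes "continuous_on {a..b} g"
  shows "(LINT x:{a..b}|lebesgue. g x) = integral {a..b} g"
  using absolutely_integrable_continuous_real[OF assms] by (rule set_lebesgue_integral_eq_integral)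

text \<open>Besides primitives of test functions, this supplies the distribution function on the
  whole line; the formula of \<open>circ_cdf\<close> is an integral over the empty set for
  \<open>x < 0\<close>.\<close>

lemma ex_antiderivative:
  fixes f :: "real \<Rightarrow> real"
  assumes "continuous_on UNIV f"
  shows "\<exists>F. (\<forall>x. (F has_real_derivative f x) (at x)) \<and> F c = 0"
proof -
  have "isCont f x" for x
    using assms by (simp add: continuous_on_eq_continuous_at)
  then obtain F where F: "\<forall>x. (F has_real_derivative f x) (at x)"
    using einterval_antiderivative[of "-\<infinity>" \<infinity> f]
    by (auto simp: has_real_derivative_iff_has_vector_derivative)
  show ?thesis
    by (rule exI[of _ "\<lambda>x. F x - F c"]) (use F in \<open>auto intro!: derivative_eq_intros\<close>)
qed

lemma antiderivative_has_integral:
  fixes F :: "real \<Rightarrow> real"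
  assumes "\<And>x. (F has_real_derivative f x) (at x)" "a \<le> b"
  shows "(f has_integral F b - F a) {a..b}"
  using assms
  by (intro fundamental_theorem_of_calculus)
    (auto simp: has_real_derivative_iff_has_vector_derivative intro: has_vector_derivative_at_within)

lemma primitive_shift_period:
  fixes F :: "real \<Rightarrow> real"
  assumes "circle_fun \<rho>" "\<And>x. (F has_real_derivative \<rho> x) (at x)"
  shows "F (x + 2 * pi) = F x + (F (2 * pi) - F 0)"
proof -
  have "((\<lambda>x. F (x + 2 * pi) - F x) has_real_derivative 0) (at x)" for x
  proof -
    have "((\<lambda>x. F (x + 2 * pi)) has_real_derivative \<rho> (x + 2 * pi)) (at x)"
      using assms(2)[of "x + 2 * pi"] by (simp add: DERIV_shift)
    from DERIV_diff[OF this assms(2)[of x]] show ?thesis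
      using assms(1) by (simp add: circle_fun_def)
  qed
  then have "F (x + 2 * pi) - F x = F (0 + 2 * pi) - F 0"
    by (rule DERIV_isconst_all[rule_format])
  then show ?thesis by simp
qed

lemma circle_fun_bump: "circle_fun g \<Longrightarrow> circle_fun (bump g n)"
  by (simp add: circle_fun_def bump_def)

lemma circle_test_fun_bump: "circle_test_fun g \<Longrightarrow> circle_test_fun (bump g n)"
  by (simp add: circle_test_fun_def circle_fun_bump smooth_bump)

lemma circle_test_fun_const: "circle_test_fun (\<lambda>_. c)"
  by (simp add: circle_test_fun_def circle_fun_def smooth_const)

text \<open>With \<open>m\<close> the midpoint of an arc and \<open>c\<close> the cosine of half its
  length, this function is positive exactly on the arc. Its bumps are therefore periodic and
  approximate the indicator of the arc.\<close>

lemma circle_test_fun_arc: "circle_test_fun (\<lambda>x. cos (x - m) - c)"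
proof -
  have "smooth (\<lambda>x. cos (x - m) - c)"
    by (intro smooth_diff smooth_const smooth_compose[OF smooth_cos] smooth_ident)
  moreover have "cos (x + 2 * pi - m) = cos (x - m)" for x
    using cos_periodic[of "x - m"] by (simp add: algebra_simps)
  ultimately show ?thesis
    by (simp add: circle_test_fun_def circle_fun_def)
qed

lemma arc_pos_iff:
  fixes x :: real
  assumes "x \<in> {0..2 * pi}" "0 \<le> c" "c < d" "d \<le> 2 * pi" "d - c < 2 * pi"
  shows "cos (x - (c + d) / 2) - cos ((d - c) / 2) > 0 \<longleftrightarrow> x \<in> {c<..<d}"
proof -
  define r where "r = (d - c) / 2"
  define y where "y = \<bar>x - (c + d) / 2\<bar>"
  have r: "0 < r" "r < pi" and y: "0 \<le> y" "y \<le> 2 * pi - r"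
    using assms by (auto simp: r_def y_def abs_if field_simps)
  have cos_y: "cos (x - (c + d) / 2) = cos y"
    by (simp add: y_def)
  have "cos y > cos r \<longleftrightarrow> y < r"
  proof (cases "y \<le> pi")
    case True
    then show ?thesis
      using cos_monotone_0_pi[of y r] cos_monotone_0_pi_le[of r y] r y by (cases "y < r") simp_all
  next
    \<comment> \<open>Here \<open>y\<close> is beyond the antipode of the midpoint. Reflection to
      \<open>2 * pi - y\<close>, which is still at least \<open>r\<close>, returns to the range
      where cosine is decreasing.\<close>
    case False
    have "cos (2 * pi - y) \<le> cos r"
      using cos_monotone_0_pi_le[of r "2 * pi - y"] r y False by auto
    then show ?thesis
      using r False by (simp add: cos_diff)
  qed
  moreover have "y < r \<longleftrightarrow> x \<in> {c<..<d}"
    by (auto simp: r_def y_def abs_if field_simps)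
  ultimately show ?thesis
    unfolding cos_y r_def[symmetric] by simp
qed

lemma LINT_indicator_interval:
  fixes h :: "real \<Rightarrow> real"
  assumes h: "set_integrable lebesgue {a..b} h" and "a \<le> c" "d \<le> b"
    and A: "\<And>x. x \<in> {a..b} \<Longrightarrow> x \<in> A \<longleftrightarrow> x \<in> {c<..<d}" "A \<in> sets lebesgue"
  shows "(LINT x:{a..b}|lebesgue. h x * indicator A x) = (LINT x:{c..d}|lebesgue. h x)"
  unfolding set_lebesgue_integral_def
proof (intro integral_cong_AE)
  have h': "(\<lambda>x. indicator {a..b} x *\<^sub>R h x) \<in> borel_measurable lebesgue"
    using h by (simp add: set_integrable_def borel_measurable_integrable)
  have "(\<lambda>x. indicator A x *\<^sub>R (indicator {a..b} x *\<^sub>R h x)) \<in> borel_measurable lebesgue"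
    by (intro borel_measurable_scaleR borel_measurable_indicator h' A)
  then show "(\<lambda>x. indicator {a..b} x *\<^sub>R (h x * indicator A x)) \<in> borel_measurable lebesgue"
    by (simp add: mult_ac)
  have "set_integrable lebesgue {c..d} h"
    by (rule set_integrable_subset[OF h]) (use assms(2,3) in auto)
  then show "(\<lambda>x. indicator {c..d} x *\<^sub>R h x) \<in> borel_measurable lebesgue"
    by (simp add: set_integrable_def borel_measurable_integrable)
  show "AE x in lebesgue. indicator {a..b} x *\<^sub>R (h x * indicator A x) = indicator {c..d} x *\<^sub>R h x"
    using AE_neq_lebesgue[of c] AE_neq_lebesgue[of d]
  proof eventually_elim
    case (elim x)
    then show ?case
      using A(1)[of x] assms(2,3) by (auto simp: indicator_def)
  qed
qed

lemma pos_set_measurable: "smooth g \<Longrightarrow> {x. g x > 0} \<in> sets lebesgue"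
  using open_Collect_less[OF continuous_on_const smooth_imp_continuous_on[of g UNIV]] by auto

text \<open>Bumps over arcs turn the hypothesis into vanishing integrals over all intervals inside
  one period.\<close>

theorem circle_fundamental_lemma:
  assumes h: "set_integrable lebesgue {0..2 * pi} h"
    and zero: "\<And>\<psi>. circle_test_fun \<psi> \<Longrightarrow> (LINT x:{0..2 * pi}|lebesgue. h x * \<psi> x) = 0"
  shows "AE x in lebesgue. x \<in> {0..2 * pi} \<longrightarrow> h x = 0"
proof (rule AE_eq_0_if_interval_integrals_eq_0[OF h])
  fix c d :: real
  assume cd: "0 \<le> c" "c < d" "d \<le> 2 * pi"
  show "(LINT x:{c..d}|lebesgue. h x) = 0"
  proof (cases "d - c < 2 * pi")
    case True
    define g where "g = (\<lambda>x. cos (x - (c + d) / 2) - cos ((d - c) / 2))"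
    have g: "circle_test_fun g"
      unfolding g_def by (rule circle_test_fun_arc)
    then have "smooth g"
      by (simp add: circle_test_fun_def)
    from bump_integral_tendsto[OF h this]
    have "(\<lambda>n. 0) \<longlonglongrightarrow> (LINT x:{0..2 * pi}|lebesgue. h x * indicator {x. g x > 0} x)"
      using zero[OF circle_test_fun_bump[OF g]] by simp
    then have "(LINT x:{0..2 * pi}|lebesgue. h x * indicator {x. g x > 0} x) = 0"
      by (simp add: LIMSEQ_const_iff)
    then show ?thesis
      using LINT_indicator_interval[OF h cd(1,3), of "{x. g x > 0}"] arc_pos_iff cd True
        pos_set_measurable[OF \<open>smooth g\<close>]
      unfolding g_def by auto
  next
    case False
    then have "c = 0" "d = 2 * pi"
      using cd by auto
    then show ?thesis
      using zero[OF circle_test_fun_const[of 1]] by simp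
  qed
qed

text \<open>It suffices to test against functions of mean zero, and each of these is the derivative of a test
  function.\<close>

theorem circle_du_Bois_Reymond:
  assumes D: "continuous_on {0..2 * pi} D"
    and zero: "\<And>\<psi>. circle_test_fun \<psi> \<Longrightarrow> (LINT x:{0..2 * pi}|lebesgue. D x * deriv \<psi> x) = 0"
    and x: "x \<in> {0..2 * pi}"
  shows "D x = D 0"
proof -
  \<comment> \<open>The mean of \<open>D\<close>. Integrating \<open>D - K\<close> against
    \<open>\<rho>\<close> then equals integrating \<open>D\<close> against
    \<open>\<rho> - c\<close>, with \<open>c\<close> the mean of \<open>\<rho>\<close>.\<close>
  define K where "K = integral {0..2 * pi} D / (2 * pi)"
  have cont: "continuous_on {0..2 * pi} (\<lambda>x. D x - K)"
    by (intro continuous_intros D)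
  have test: "(LINT x:{0..2 * pi}|lebesgue. (D x - K) * \<rho> x) = 0" if \<rho>: "circle_test_fun \<rho>" for \<rho>
  proof -
    have \<rho>_cont: "continuous_on S \<rho>" for S
      using \<rho> by (intro smooth_imp_continuous_on) (simp add: circle_test_fun_def)
    define c where "c = integral {0..2 * pi} \<rho> / (2 * pi)"
    obtain \<psi> where \<psi>: "\<And>x. (\<psi> has_real_derivative \<rho> x - c) (at x)"
      using ex_antiderivative[OF continuous_on_diff[OF \<rho>_cont continuous_on_const[of _ c]]] by blast
    have "((\<lambda>x. \<rho> x - c) has_integral \<psi> (2 * pi) - \<psi> 0) {0..2 * pi}"
      by (rule antiderivative_has_integral[OF \<psi>]) simp
    moreover have "((\<lambda>_. c) has_integral 2 * pi * c) {0..2 * pi}"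
      using has_integral_const_real[of c 0 "2 * pi"] by simp
    then have "((\<lambda>x. \<rho> x - c) has_integral integral {0..2 * pi} \<rho> - 2 * pi * c) {0..2 * pi}"
      by (intro has_integral_diff integrable_integral integrable_continuous_real \<rho>_cont)
    ultimately have "\<psi> (2 * pi) - \<psi> 0 = integral {0..2 * pi} \<rho> - 2 * pi * c"
      by (rule has_integral_unique)
    then have "\<psi> (2 * pi) = \<psi> 0"
      by (simp add: c_def)
    moreover have "circle_fun (\<lambda>x. \<rho> x - c)"
      using \<rho> by (simp add: circle_test_fun_def circle_fun_def)
    ultimately have "circle_fun \<psi>"
      using primitive_shift_period[OF _ \<psi>] by (simp add: circle_fun_def)
    moreover have "smooth (\<lambda>x. \<rho> x - c)"
      using \<rho> by (intro smooth_diff smooth_const) (simp add: circle_test_fun_def)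
    ultimately have "circle_test_fun \<psi>"
      using smooth_primitive[OF \<psi>] by (simp add: circle_test_fun_def)
    moreover have "deriv \<psi> = (\<lambda>x. \<rho> x - c)"
      using \<psi> by (intro ext DERIV_imp_deriv)
    ultimately have "(LINT x:{0..2 * pi}|lebesgue. D x * (\<rho> x - c)) = 0"
      using zero by metis
    then have "integral {0..2 * pi} (\<lambda>x. D x * (\<rho> x - c)) = 0"
      by (subst (asm) LINT_continuous) (intro continuous_intros D \<rho>_cont)+
    moreover have "integral {0..2 * pi} (\<lambda>x. D x * (\<rho> x - c))
        = integral {0..2 * pi} (\<lambda>x. D x * \<rho> x) - integral {0..2 * pi} D * c"
      unfolding right_diff_distrib
      by (subst integral_diff)
        (simp_all add: integrable_continuous_real continuous_on_mult D \<rho>_cont)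
    moreover have "integral {0..2 * pi} (\<lambda>x. (D x - K) * \<rho> x)
        = integral {0..2 * pi} (\<lambda>x. D x * \<rho> x) - K * integral {0..2 * pi} \<rho>"
      unfolding left_diff_distrib
      by (subst integral_diff)
        (simp_all add: integrable_continuous_real continuous_on_mult D \<rho>_cont)
    ultimately have "integral {0..2 * pi} (\<lambda>x. (D x - K) * \<rho> x) = 0"
      by (simp add: c_def K_def)
    then show ?thesis
      by (subst LINT_continuous) (intro continuous_intros D \<rho>_cont)+
  qed
  have "D y - K = 0" if "y \<in> {0..2 * pi}" for y
    by (rule continuous_AE_eq_0_imp_eq_0[OF cont _ circle_fundamental_lemma that])
      (use test absolutely_integrable_continuous_real[OF cont] in auto)
  from this[of x] this[of 0] show ?thesis
    using x by simp
qed

section \<open>Test functions in time\<close>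

definition time_test_fun :: "real \<Rightarrow> (real \<Rightarrow> real) \<Rightarrow> bool" where
  "time_test_fun T \<eta> \<longleftrightarrow>
     smooth \<eta> \<and> compact (closure {t. \<eta> t \<noteq> 0}) \<and> closure {t. \<eta> t \<noteq> 0} \<subseteq> {0<..<T}"

lemma time_test_funI:
  assumes "smooth \<eta>" "0 < A" "B < T" "\<And>t. t \<notin> {A..B} \<Longrightarrow> \<eta> t = 0"
  shows "time_test_fun T \<eta>"
proof -
  have "closure {t. \<eta> t \<noteq> 0} \<subseteq> {A..B}"
    using assms(4) by (intro closure_minimal subsetI) (blast, simp)
  moreover from this have "bounded (closure {t. \<eta> t \<noteq> 0})"
    using bounded_subset bounded_closed_interval by metis
  ultimately show ?thesis
    using assms(1-3) unfolding time_test_fun_def compact_eq_bounded_closed by force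
qed

text \<open>A constant cannot be subtracted from a test function as on the circle, because the
  support must stay inside the open interval. A fixed bump \<open>\<rho>0\<close> over the middle
  third, with integral \<open>Z \<noteq> 0\<close>, takes over the role of the constant.\<close>

theorem time_du_Bois_Reymond:
  assumes T: "0 < T" and c: "continuous_on {0..T} c"
    and zero: "\<And>\<eta>. time_test_fun T \<eta> \<Longrightarrow> (LINT t:{0..T}|lebesgue. deriv \<eta> t * c t) = 0"
    and t: "t \<in> {0..T}"
  shows "c t = c 0"
proof -
  define g0 where "g0 = (\<lambda>t::real. (t - T / 3) * (2 * T / 3 - t))"
  define \<rho>0 where "\<rho>0 = bump g0 0"
  have "smooth g0"
    unfolding g0_def by (intro smooth_mult smooth_diff smooth_const smooth_ident)
  then have \<rho>0: "smooth \<rho>0"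
    unfolding \<rho>0_def by (rule smooth_bump)
  have \<rho>0_cont: "continuous_on S \<rho>0" for S
    by (rule smooth_imp_continuous_on[OF \<rho>0])
  have \<rho>0_supp: "\<rho>0 t = 0" if "t \<notin> {T / 3..2 * T / 3}" for t
    unfolding \<rho>0_def by (rule bump_eq_0) (use that T in \<open>auto simp: g0_def mult_le_0_iff\<close>)
  have \<rho>0_nonneg: "\<rho>0 t \<ge> 0" for t
    by (simp add: \<rho>0_def bump_bounds)
  define Z where "Z = integral {0..T} \<rho>0"
  have "\<rho>0 (T / 2) > 0"
    using T by (simp add: \<rho>0_def bump_pos_iff g0_def)
  then have "Z \<noteq> 0"
    using integral_eq_0_iff[OF \<rho>0_cont T] \<rho>0_nonneg T unfolding Z_def by force
  \<comment> \<open>The mean of \<open>c\<close> weighted by \<open>\<rho>0\<close>; it will turn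
    out to be the constant value of \<open>c\<close>.\<close>
  define K where "K = integral {0..T} (\<lambda>t. \<rho>0 t * c t) / Z"
  have cK: "continuous_on {0..T} (\<lambda>t. c t - K)"
    by (intro continuous_intros c)
  have test: "(LINT t:{0..T}|lebesgue. (c t - K) * \<rho> t) = 0"
    if \<rho>: "smooth \<rho>" and AB: "0 < A" "B < T" and supp: "\<And>t. t \<notin> {A..B} \<Longrightarrow> \<rho> t = 0" for \<rho> A B
  proof -
    have \<rho>_cont: "continuous_on S \<rho>" for S
      by (rule smooth_imp_continuous_on[OF \<rho>])
    \<comment> \<open>Chosen so that \<open>\<rho> - z * \<rho>0\<close> has integral 0, which is
      what makes its primitive vanish near both ends.\<close>
    define z where "z = integral {0..T} \<rho> / Z"
    define \<rho>1 where "\<rho>1 = (\<lambda>t. \<rho> t - z * \<rho>0 t)"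
    define A' B' where "A' = min A (T / 3)" and "B' = max B (2 * T / 3)"
    have AB': "0 < A'" "A' \<le> B'" "B' < T"
      using AB T by (auto simp: A'_def B'_def)
    have supp1: "\<rho>1 t = 0" if "t \<notin> {A'..B'}" for t
      using that supp[of t] \<rho>0_supp[of t] by (auto simp: \<rho>1_def A'_def B'_def min_def max_def split: if_splits)
    have \<rho>1_cont: "continuous_on S \<rho>1" for S
      unfolding \<rho>1_def by (intro continuous_intros \<rho>_cont \<rho>0_cont)
    obtain \<eta> where \<eta>: "\<And>t. (\<eta> has_real_derivative \<rho>1 t) (at t)" and \<eta>0: "\<eta> 0 = 0"
      using ex_antiderivative[OF \<rho>1_cont, of 0] by blast
    have "(\<rho>1 has_integral \<eta> T - \<eta> 0) {0..T}"
      by (rule antiderivative_has_integral[OF \<eta>]) (use T in simp)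
    moreover have "(\<rho>1 has_integral integral {0..T} \<rho> - z * Z) {0..T}"
      unfolding \<rho>1_def Z_def
      by (intro has_integral_diff has_integral_mult_right integrable_integral
          integrable_continuous_real \<rho>_cont \<rho>0_cont)
    ultimately have "\<eta> T - \<eta> 0 = integral {0..T} \<rho> - z * Z"
      by (rule has_integral_unique)
    then have \<eta>T: "\<eta> T = 0"
      using \<open>Z \<noteq> 0\<close> by (simp add: z_def \<eta>0)
    have const: "\<eta> x = \<eta> y" if "x \<le> y" "\<And>t. t \<in> {x<..<y} \<Longrightarrow> \<rho>1 t = 0" for x y
    proof (cases "x = y")
      case False
      then have "x < y" using that by simp
      then obtain s where "s \<in> {x<..<y}" "\<eta> y - \<eta> x = (y - x) * \<rho>1 s"
        using MVT2[OF \<open>x < y\<close>, of \<eta> \<rho>1] \<eta> by auto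
      with that(2) show ?thesis by simp
    qed simp
    \<comment> \<open>\<open>\<eta>\<close> is constant on either side of the support of
      \<open>\<rho>1\<close>, and its values at 0 and \<open>T\<close> fix both constants, also for
      \<open>t\<close> outside the time interval.\<close>
    have "\<eta> t = 0" if t: "t \<notin> {A'..B'}" for t
    proof -
      consider "t < A'" "t \<le> 0" | "t < A'" "0 \<le> t" | "t > B'" "t \<le> T" | "t > B'" "T \<le> t"
        using t by fastforce
      then show ?thesis
      proof cases
        case 1 then show ?thesis using const[of t 0] supp1 AB' \<eta>0 by auto
      next
        case 2 then show ?thesis using const[of 0 t] supp1 AB' \<eta>0 by auto
      next
        case 3 then show ?thesis using const[of t T] supp1 AB' \<eta>T by auto
      next
        case 4 then show ?thesis using const[of T t] supp1 AB' \<eta>T by auto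
      qed
    qed
    moreover have "smooth \<rho>1"
      unfolding \<rho>1_def by (intro smooth_diff smooth_mult smooth_const \<rho> \<rho>0)
    ultimately have "time_test_fun T \<eta>"
      using AB' smooth_primitive[OF \<eta>] by (intro time_test_funI[of _ A' B'])
    moreover have "deriv \<eta> = \<rho>1"
      by (intro ext DERIV_imp_deriv \<eta>)
    ultimately have "integral {0..T} (\<lambda>t. \<rho>1 t * c t) = 0"
      using zero LINT_continuous[OF continuous_on_mult[OF \<rho>1_cont c]] by metis
    moreover have "((\<lambda>t. \<rho> t * c t - z * (\<rho>0 t * c t)) has_integral
        integral {0..T} (\<lambda>t. \<rho> t * c t) - z * integral {0..T} (\<lambda>t. \<rho>0 t * c t)) {0..T}"
      by (intro has_integral_diff has_integral_mult_right integrable_integral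
          integrable_continuous_real continuous_on_mult \<rho>_cont \<rho>0_cont c)
    then have "integral {0..T} (\<lambda>t. \<rho>1 t * c t)
        = integral {0..T} (\<lambda>t. \<rho> t * c t) - z * integral {0..T} (\<lambda>t. \<rho>0 t * c t)"
      by (intro integral_unique) (simp add: \<rho>1_def left_diff_distrib mult.assoc)
    moreover have "((\<lambda>t. c t * \<rho> t - K * \<rho> t) has_integral
        integral {0..T} (\<lambda>t. c t * \<rho> t) - K * integral {0..T} \<rho>) {0..T}"
      by (intro has_integral_diff has_integral_mult_right integrable_integral
          integrable_continuous_real continuous_on_mult \<rho>_cont \<rho>0_cont c)
    then have "integral {0..T} (\<lambda>t. (c t - K) * \<rho> t)
        = integral {0..T} (\<lambda>t. c t * \<rho> t) - K * integral {0..T} \<rho>"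
      by (intro integral_unique) (simp add: left_diff_distrib)
    ultimately have "integral {0..T} (\<lambda>t. (c t - K) * \<rho> t) = 0"
      by (simp add: z_def K_def mult.commute[of "c _"])
    then show ?thesis
      by (subst LINT_continuous[OF continuous_on_mult[OF cK \<rho>_cont]])
  qed
  have interval: "(LINT t:{a..b}|lebesgue. c t - K) = 0" if ab: "0 < a" "a < b" "b < T" for a b
  proof -
    define g where "g = (\<lambda>t. (t - a) * (b - t))"
    have g: "smooth g"
      unfolding g_def by (intro smooth_mult smooth_diff smooth_const smooth_ident)
    have cK': "set_integrable lebesgue {0..T} (\<lambda>t. c t - K)"
      by (rule absolutely_integrable_continuous_real[OF cK])
    have "(LINT t:{0..T}|lebesgue. (c t - K) * bump g n t) = 0" for n
      by (rule test[OF smooth_bump[OF g] ab(1,3)], rule bump_eq_0)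
        (use ab in \<open>auto simp: g_def mult_le_0_iff\<close>)
    with bump_integral_tendsto[OF cK' g]
    have "(LINT t:{0..T}|lebesgue. (c t - K) * indicator {t. g t > 0} t) = 0"
      by (simp add: LIMSEQ_const_iff)
    moreover have "g t > 0 \<longleftrightarrow> t \<in> {a<..<b}" for t
      using ab by (auto simp: g_def zero_less_mult_iff)
    ultimately show ?thesis
      using LINT_indicator_interval[OF cK', of a b "{t. g t > 0}"] pos_set_measurable[OF g] ab by simp
  qed
  have inner: "c t = K" if "t \<in> {0<..<T}" for t
  proof -
    define a b where "a = t / 2" and "b = (t + T) / 2"
    have ab: "0 < a" "a < t" "t < b" "b < T"
      using that by (auto simp: a_def b_def)
    have cont: "continuous_on {a..b} (\<lambda>t. c t - K)"
      by (rule continuous_on_subset[OF cK]) (use ab in auto)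
    have "AE t in lebesgue. t \<in> {a..b} \<longrightarrow> c t - K = 0"
      by (rule AE_eq_0_if_interval_integrals_eq_0)
        (use ab interval absolutely_integrable_continuous_real[OF cont] in auto)
    from continuous_AE_eq_0_imp_eq_0[OF cont _ this, of t] ab show ?thesis
      by simp
  qed
  \<comment> \<open>Test functions see only interior times; continuity of \<open>c\<close> adds the
    two endpoints.\<close>
  have "c t = K" if "t \<in> {0..T}" for t
    using continuous_constant_on_closure[of "{0<..<T}" c K t] inner c that T by simp
  with t T show ?thesis by simp
qed

section \<open>Fubini's theorem for Lebesgue measurable functions\<close>

text \<open>Completed product measures: a Lebesgue measurable function is replaced by a Borel one that
  agrees with it off a null set, so that almost all of its sections agree in either variable.\<close>

lemma lborel_AE_swap:
  fixes N :: "(real \<times> real) set"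
  assumes "N \<in> null_sets lborel"
  shows "AE t in lborel. AE x in lborel. (t, x) \<notin> N" "AE x in lborel. AE t in lborel. (t, x) \<notin> N"
proof -
  have N: "N \<in> null_sets (lborel \<Otimes>\<^sub>M lborel)"
    using assms by (simp add: lborel_prod)
  then have "AE z in lborel \<Otimes>\<^sub>M lborel. z \<notin> N"
    by (rule AE_not_in)
  from lborel_pair.AE_pair[OF this] show 1: "AE t in lborel. AE x in lborel. (t, x) \<notin> N" .
  have "- N \<in> sets borel"
    using assms by (auto intro!: borel_comp simp: null_sets_def)
  then have "{z \<in> space (lborel \<Otimes>\<^sub>M lborel). (fst z, snd z) \<notin> N} \<in> sets (lborel \<Otimes>\<^sub>M lborel)"
    unfolding lborel_prod by (simp add: Compl_eq)
  from lborel_pair.AE_commute[OF this] 1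
  show "AE x in lborel. AE t in lborel. (t, x) \<notin> N" by simp
qed

text \<open>Measurability of \<open>p\<close> is a consequence of completeness. This lets
  \<open>p\<close> be an inner integral about which only almost everywhere information is
  available.\<close>

lemma lebesgue_integral_eq_lborel:
  fixes p q :: "real \<Rightarrow> real"
  assumes q: "q \<in> borel_measurable lborel" and eq: "AE x in lborel. p x = q x"
  shows "(LINT x|lebesgue. p x) = (LINT x|lborel. q x)"
proof -
  have q': "q \<in> borel_measurable lebesgue"
    by (rule measurable_completion[OF q])
  have eq': "AE x in lebesgue. q x = p x"
    using AE_completion[OF eq] by eventually_elim simp
  have "p \<in> borel_measurable lebesgue"
    using borel_measurable_AE[OF q' eq'] .
  then have "(LINT x|lebesgue. p x) = (LINT x|lebesgue. q x)"
    using q' eq' by (intro integral_cong_AE) (auto elim: eventually_mono)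
  also have "\<dots> = (LINT x|lborel. q x)"
    by (rule integral_completion[OF q])
  finally show ?thesis .
qed

theorem Fubini_set_lebesgue_integral:
  fixes h :: "real \<Rightarrow> real \<Rightarrow> real"
  assumes meas: "(\<lambda>(t, x). h t x) \<in> borel_measurable (lebesgue_on ({a..b} \<times> {c..d}))"
    and bound: "AE t in lebesgue. t \<in> {a..b} \<longrightarrow>
      set_integrable lebesgue {c..d} (h t) \<and> (LINT x:{c..d}|lebesgue. \<bar>h t x\<bar>) \<le> B"
  shows "(LINT t:{a..b}|lebesgue. LINT x:{c..d}|lebesgue. h t x)
       = (LINT x:{c..d}|lebesgue. LINT t:{a..b}|lebesgue. h t x)"
proof -
  define H where "H = (\<lambda>z. if z \<in> {a..b} \<times> {c..d} then (\<lambda>(t, x). h t x) z else 0)"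
  have H_eq: "H (t, x) = indicator {a..b} t * (indicator {c..d} x * h t x)" for t x
    by (auto simp: H_def indicator_def)
  have H_eq': "H (t, x) = indicator {c..d} x * (indicator {a..b} t * h t x)" for t x
    by (auto simp: H_def indicator_def)
  have "closed ({a..b} \<times> {c..d})"
    by (intro closed_Times) auto
  then have "{a..b} \<times> {c..d} \<in> sets lebesgue"
    by auto
  then have "H \<in> borel_measurable lebesgue"
    using meas unfolding H_def by (subst borel_measurable_if)
  then obtain q where q: "q \<in> borel_measurable lborel" and Hq: "AE z in lborel. H z = q z"
    using completion_ex_borel_measurable_real by blast
  obtain N where N: "N \<in> null_sets lborel" "{z \<in> space lborel. H z \<noteq> q z} \<subseteq> N"
    using Hq unfolding eventually_ae_filter by blast
  have N': "H z = q z" if "z \<notin> N" for z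
    using N(2) that by auto
  have AE_t: "AE t in lborel. AE x in lborel. H (t, x) = q (t, x)"
    using lborel_AE_swap(1)[OF N(1)] by eventually_elim (auto elim!: eventually_mono intro: N')
  have AE_x: "AE x in lborel. AE t in lborel. H (t, x) = q (t, x)"
    using lborel_AE_swap(2)[OF N(1)] by eventually_elim (auto elim!: eventually_mono intro: N')
  have q_prod: "q \<in> borel_measurable (lborel \<Otimes>\<^sub>M lborel)"
    using q by (simp add: lborel_prod)
  have q_t: "(\<lambda>x. q (t, x)) \<in> borel_measurable lborel" for t
    by (rule measurable_compose[OF measurable_Pair1' q_prod]) simp
  have q_x: "(\<lambda>t. q (t, x)) \<in> borel_measurable lborel" for x
    by (rule measurable_compose[OF measurable_Pair2' q_prod]) simp
  have bound': "AE t in lborel. integrable lborel (\<lambda>x. q (t, x)) \<and>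
      (LINT x|lborel. norm (q (t, x))) \<le> indicator {a..b} t * max 0 B"
    using AE_t bound[unfolded AE_completion_iff]
  proof eventually_elim
    case (elim t)
    have eq: "AE x in lebesgue. H (t, x) = q (t, x)"
      by (rule AE_completion[OF elim(1)])
    have q': "(\<lambda>x. q (t, x)) \<in> borel_measurable lebesgue"
      by (rule measurable_completion[OF q_t])
    have int: "integrable lebesgue (\<lambda>x. H (t, x))" and
      le: "(LINT x|lebesgue. norm (H (t, x))) \<le> indicator {a..b} t * max 0 B"
      using elim(2) by (auto simp: H_eq set_integrable_def set_lebesgue_integral_def indicator_def abs_mult)
    have "integrable lebesgue (\<lambda>x. q (t, x))"
      by (rule integrable_cong_AE_imp[OF int q' eq])
    then have "integrable lborel (\<lambda>x. q (t, x))"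
      using q_t by (simp add: integrable_completion)
    moreover have "(LINT x|lebesgue. norm (H (t, x))) = (LINT x|lborel. norm (q (t, x)))"
      using q_t elim(1) by (intro lebesgue_integral_eq_lborel) (auto elim!: eventually_mono)
    ultimately show ?case
      using le by simp
  qed
  \<comment> \<open>A common bound for the norms of the sections over a bounded interval of
    \<open>t\<close> makes the iterated integral of \<open>\<bar>q\<bar>\<close> finite, hence
    \<open>q\<close> jointly integrable. With \<open>max 0 B\<close> the majorant is nonnegative for
    every \<open>B\<close>.\<close>
  have "integrable lborel (\<lambda>t. LINT x|lborel. norm (q (t, x)))"
  proof (rule Bochner_Integration.integrable_bound)
    show "integrable lborel (\<lambda>t. indicator {a..b} t * max 0 B)"
      by (intro integrable_mult_left integrable_real_indicator) (auto simp: emeasure_lborel_Icc_eq)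
    have "(\<lambda>z. norm (q z)) \<in> borel_measurable (lborel \<Otimes>\<^sub>M lborel)"
      using q_prod by simp
    then show "(\<lambda>t. LINT x|lborel. norm (q (t, x))) \<in> borel_measurable lborel"
      by (intro lborel.borel_measurable_lebesgue_integral) (simp add: split_def)
    show "AE t in lborel. norm (LINT x|lborel. norm (q (t, x))) \<le> norm (indicator {a..b} t * max 0 B)"
      using bound' by eventually_elim (auto simp: abs_mult)
  qed
  then have q_int: "integrable (lborel \<Otimes>\<^sub>M lborel) q"
    using bound' by (intro lborel_pair.Fubini_integrable q_prod) (auto elim!: eventually_mono)
  have meas_t: "(\<lambda>t. LINT x|lborel. q (t, x)) \<in> borel_measurable lborel"
    using q_prod by (intro lborel.borel_measurable_lebesgue_integral) (simp add: split_def)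
  have meas_x: "(\<lambda>x. LINT t|lborel. q (t, x)) \<in> borel_measurable lborel"
    using measurable_pair_swap[OF q_prod]
    by (intro lborel.borel_measurable_lebesgue_integral) (simp add: split_def)
  have "(LINT t:{a..b}|lebesgue. LINT x:{c..d}|lebesgue. h t x) = (LINT t|lebesgue. LINT x|lebesgue. H (t, x))"
    unfolding set_lebesgue_integral_def
    by (intro Bochner_Integration.integral_cong) (auto simp: H_eq)
  also have "\<dots> = (LINT t|lborel. LINT x|lborel. q (t, x))"
    using AE_t by (intro lebesgue_integral_eq_lborel[OF meas_t])
      (auto elim!: eventually_mono intro!: lebesgue_integral_eq_lborel[OF q_t])
  also have "\<dots> = (LINT x|lborel. LINT t|lborel. q (t, x))"
    using lborel_pair.Fubini_integral[of "\<lambda>t x. q (t, x)"] q_int by simp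
  also have "\<dots> = (LINT x|lebesgue. LINT t|lebesgue. H (t, x))"
    using AE_x by (intro lebesgue_integral_eq_lborel[OF meas_x, symmetric])
      (auto elim!: eventually_mono intro!: lebesgue_integral_eq_lborel[OF q_x])
  also have "\<dots> = (LINT x:{c..d}|lebesgue. LINT t:{a..b}|lebesgue. h t x)"
    unfolding set_lebesgue_integral_def
    by (intro Bochner_Integration.integral_cong) (auto simp: H_eq')
  finally show ?thesis .
qed

lemma set_integrable_mult_continuous:
  fixes h \<psi> :: "real \<Rightarrow> real"
  assumes h: "set_integrable lebesgue {a..b} h" and \<psi>: "continuous_on {a..b} \<psi>"
  shows "set_integrable lebesgue {a..b} (\<lambda>x. h x * \<psi> x)"
proof -
  have "compact (\<psi> ` {a..b})"
    by (intro compact_continuous_image \<psi>) simp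
  then have "bounded (\<psi> ` {a..b})"
    by (rule compact_imp_bounded)
  moreover have "\<psi> \<in> borel_measurable (lebesgue_on {a..b})"
    using \<psi> by (intro continuous_imp_measurable_on_sets_lebesgue) auto
  ultimately show ?thesis
    using absolutely_integrable_bounded_measurable_product_real[of \<psi> "{a..b}" h] h
    by (simp add: mult.commute)
qed

section \<open>Evolution of the distribution function\<close>

lemma AE_lebesgue_on_Icc:
  "(AE t in lebesgue_on {a..b::real}. P t) \<longleftrightarrow> (AE t in lebesgue. t \<in> {a..b} \<longrightarrow> P t)"
  by (rule AE_restrict_space_iff) simp

section \<open>Integrability from Sobolev bounds\<close>

lemma circle_Lp_2_imp_1: "circle_Lp 2 g \<Longrightarrow> circle_Lp 1 g"
  and circle_Lp_1_integrable: "circle_Lp 1 g \<Longrightarrow> set_integrable lebesgue {0..2 * pi} g"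
proof -
  show *: "set_integrable lebesgue {0..2 * pi} g" if "circle_Lp 1 g" for g
    using that set_integrable_abs_iff'[of g lebesgue "{0..2 * pi}"] by (simp add: circle_Lp_def)
  assume g: "circle_Lp 2 g"
  then have [measurable]: "g \<in> borel_measurable lebesgue"
    by (simp add: circle_Lp_def)
  have "set_integrable lebesgue {0..2 * pi} (\<lambda>x. 1 + \<bar>g x\<bar> powr 2)"
    using g set_integral_add(1)[OF absolutely_integrable_continuous_real[OF continuous_on_const]]
    by (simp add: circle_Lp_def)
  then have "set_integrable lebesgue {0..2 * pi} (\<lambda>x. \<bar>g x\<bar> powr 1)"
  proof (rule set_integrable_bound)
    show "set_borel_measurable lebesgue {0..2 * pi} (\<lambda>x. \<bar>g x\<bar> powr 1)"
      unfolding set_borel_measurable_def by (intro borel_measurable_scaleR borel_measurable_indicator) auto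
    show "AE x in lebesgue. x \<in> {0..2 * pi} \<longrightarrow> norm (\<bar>g x\<bar> powr 1) \<le> norm (1 + \<bar>g x\<bar> powr 2)"
    proof (intro AE_I2 impI)
      fix x
      have "0 \<le> (\<bar>g x\<bar> - 1)\<^sup>2" by simp
      then show "norm (\<bar>g x\<bar> powr 1) \<le> norm (1 + \<bar>g x\<bar> powr 2)"
        by (simp add: power2_eq_square algebra_simps)
    qed
  qed
  with g show "circle_Lp 1 g"
    by (simp add: circle_Lp_def)
qed

lemma circle_weak_deriv_0_unique:
  assumes g: "circle_Lp 1 g" and w: "circle_Lp 1 w" "circle_weak_deriv 0 g w"
  shows "AE x in lebesgue. x \<in> {0..2 * pi} \<longrightarrow> g x = w x"
proof -
  note gi = circle_Lp_1_integrable[OF g] and wi = circle_Lp_1_integrable[OF w(1)]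
  have "AE x in lebesgue. x \<in> {0..2 * pi} \<longrightarrow> g x - w x = 0"
  proof (rule circle_fundamental_lemma)
    show "set_integrable lebesgue {0..2 * pi} (\<lambda>x. g x - w x)"
      by (rule set_integral_diff(1)[OF gi wi])
    fix \<psi> assume \<psi>: "circle_test_fun \<psi>"
    then have cont: "continuous_on {0..2 * pi} \<psi>"
      by (intro smooth_imp_continuous_on) (simp add: circle_test_fun_def)
    have "(LINT x:{0..2 * pi}|lebesgue. g x * \<psi> x) = (LINT x:{0..2 * pi}|lebesgue. w x * \<psi> x)"
      using w(2) \<psi> by (auto simp: circle_weak_deriv_def)
    then show "(LINT x:{0..2 * pi}|lebesgue. (g x - w x) * \<psi> x) = 0"
      unfolding left_diff_distrib
      using set_integral_diff(2)[OF set_integrable_mult_continuous[OF gi cont]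
          set_integrable_mult_continuous[OF wi cont]] by simp
  qed
  then show ?thesis by simp
qed

text \<open>The norm is computed from \<open>circle_wderiv 0 g\<close>, a choice which agrees with \<open>g\<close> only almost
  everywhere on a period.\<close>

lemma sobolev_norm_L1_bound:
  assumes g: "circle_sobolev m 2 g" and M: "circle_sobolev_norm m 2 g \<le> M"
  shows "set_integrable lebesgue {0..2 * pi} g"
    "(LINT x:{0..2 * pi}|lebesgue. \<bar>g x\<bar>) \<le> 2 * pi + M\<^sup>2"
proof -
  have g2: "circle_Lp 2 g"
    using g by (simp add: circle_sobolev_def)
  then have g1: "circle_Lp 1 g"
    by (rule circle_Lp_2_imp_1)
  show gi: "set_integrable lebesgue {0..2 * pi} g"
    by (rule circle_Lp_1_integrable[OF g1])
  define w where "w = circle_wderiv 0 g"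
  \<comment> \<open>\<open>g\<close> is itself a candidate in the choice behind
    \<open>circle_wderiv 0 g\<close>, so the chosen \<open>w\<close> has the defining
    property.\<close>
  have "circle_Lp 1 g \<and> circle_weak_deriv 0 g g"
    using g1 by (simp add: circle_weak_deriv_def)
  then have w: "circle_Lp 1 w \<and> circle_weak_deriv 0 g w"
    unfolding w_def circle_wderiv_def
    by (rule someI[of "\<lambda>u. circle_Lp 1 u \<and> circle_weak_deriv 0 g u"])
  then have gw: "AE x in lebesgue. x \<in> {0..2 * pi} \<longrightarrow> g x = w x"
    using circle_weak_deriv_0_unique[OF g1] by blast
  have [measurable]: "g \<in> borel_measurable lebesgue" "w \<in> borel_measurable lebesgue"
    using g1 w by (auto simp: circle_Lp_def)
  define S where "S = (\<Sum>j\<le>m. LINT x:{0..2 * pi}|lebesgue. \<bar>circle_wderiv j g x\<bar> powr 2)"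
  have nonneg: "0 \<le> (LINT x:{0..2 * pi}|lebesgue. \<bar>u x\<bar> powr 2)" for u :: "real \<Rightarrow> real"
    unfolding set_lebesgue_integral_def by (intro integral_nonneg_AE) auto
  have "S powr (1 / 2) \<le> M"
    using M by (simp add: circle_sobolev_norm_def S_def)
  moreover have "0 \<le> S"
    unfolding S_def by (intro sum_nonneg nonneg)
  ultimately have "S \<le> M\<^sup>2"
    using power_mono[of "sqrt S" M 2] by (simp add: powr_half_sqrt)
  have "(LINT x:{0..2 * pi}|lebesgue. \<bar>g x\<bar> powr 2) = (LINT x:{0..2 * pi}|lebesgue. \<bar>w x\<bar> powr 2)"
    unfolding set_lebesgue_integral_def
  proof (rule integral_cong_AE)
    show "(\<lambda>x. indicator {0..2 * pi} x *\<^sub>R \<bar>g x\<bar> powr 2) \<in> borel_measurable lebesgue"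
      "(\<lambda>x. indicator {0..2 * pi} x *\<^sub>R \<bar>w x\<bar> powr 2) \<in> borel_measurable lebesgue"
      by (intro borel_measurable_scaleR borel_measurable_indicator; simp)+
    show "AE x in lebesgue. indicator {0..2 * pi} x *\<^sub>R \<bar>g x\<bar> powr 2
        = indicator {0..2 * pi} x *\<^sub>R \<bar>w x\<bar> powr 2"
      using gw by eventually_elim (auto simp: indicator_def)
  qed
  also have "\<dots> \<le> S"
    unfolding S_def w_def
    by (rule member_le_sum[of 0 "{..m}" "\<lambda>j. LINT x:{0..2 * pi}|lebesgue. \<bar>circle_wderiv j g x\<bar> powr 2"])
      (simp, rule nonneg, simp)
  finally have le: "(LINT x:{0..2 * pi}|lebesgue. \<bar>g x\<bar> powr 2) \<le> M\<^sup>2"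
    using \<open>S \<le> M\<^sup>2\<close> by simp
  have i1: "set_integrable lebesgue {0..2 * pi} (\<lambda>_. 1 :: real)"
    by (rule absolutely_integrable_continuous_real) simp
  have i2: "set_integrable lebesgue {0..2 * pi} (\<lambda>x. \<bar>g x\<bar> powr 2)"
    using g2 by (simp add: circle_Lp_def)
  \<comment> \<open>The bound comes from
    \<open>\<bar>g\<bar> \<le> 1 + \<bar>g\<bar>\<^sup>2\<close>: the period contributes
    \<open>2 * pi\<close> and the squared norm at most \<open>M\<^sup>2\<close>.\<close>
  have "(LINT x:{0..2 * pi}|lebesgue. \<bar>g x\<bar>)
      \<le> (LINT x:{0..2 * pi}|lebesgue. 1 + \<bar>g x\<bar> powr 2)"
  proof (rule set_integral_mono)
    show "set_integrable lebesgue {0..2 * pi} (\<lambda>x. \<bar>g x\<bar>)"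
      by (rule set_integrable_abs[OF gi])
    show "set_integrable lebesgue {0..2 * pi} (\<lambda>x. 1 + \<bar>g x\<bar> powr 2)"
      by (rule set_integral_add(1)[OF i1 i2])
    show "\<bar>g x\<bar> \<le> 1 + \<bar>g x\<bar> powr 2" for x
    proof -
      have "0 \<le> (\<bar>g x\<bar> - 1)\<^sup>2" by simp
      then show ?thesis by (simp add: power2_eq_square algebra_simps)
    qed
  qed
  also have "\<dots> = 2 * pi + (LINT x:{0..2 * pi}|lebesgue. \<bar>g x\<bar> powr 2)"
    using LINT_continuous[of 0 "2 * pi" "\<lambda>_. 1"] by (subst set_integral_add(2)[OF i1 i2]) simp
  finally show "(LINT x:{0..2 * pi}|lebesgue. \<bar>g x\<bar>) \<le> 2 * pi + M\<^sup>2"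
    using le by simp
qed

section \<open>Functions of time and space, and evolution of their moments\<close>

lemma continuous_on_slice:
  fixes F :: "real \<Rightarrow> real \<Rightarrow> real"
  assumes "continuous_on (S \<times> UNIV) (\<lambda>(t, x). F t x)" "t \<in> S"
  shows "continuous_on X (F t)"
proof -
  have "continuous_on X ((\<lambda>(t, x). F t x) \<circ> Pair t)"
    using assms(2)
    by (intro continuous_on_compose continuous_intros continuous_on_subset[OF assms(1)]) auto
  then show ?thesis by (simp add: comp_def)
qed

lemma continuous_on_slice':
  fixes F :: "real \<Rightarrow> real \<Rightarrow> real"
  assumes "continuous_on (S \<times> UNIV) (\<lambda>(t, x). F t x)"
  shows "continuous_on S (\<lambda>t. F t x)"
proof -
  have "continuous_on S ((\<lambda>(t, x). F t x) \<circ> (\<lambda>t. (t, x)))"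
    by (intro continuous_on_compose continuous_intros continuous_on_subset[OF assms]) auto
  then show ?thesis by (simp add: comp_def)
qed

lemma continuous_on_pair_mult:
  fixes F :: "real \<Rightarrow> real \<Rightarrow> real"
  assumes F: "continuous_on (S \<times> UNIV) (\<lambda>(t, x). F t x)"
    and a: "continuous_on S a" and b: "continuous_on UNIV b"
  shows "continuous_on (S \<times> X) (\<lambda>(t, x). a t * F t x * b x)"
proof -
  have "continuous_on (S \<times> X) (\<lambda>z. a (fst z) * (case z of (t, x) \<Rightarrow> F t x) * b (snd z))"
    by (intro continuous_on_mult continuous_on_compose2[OF a] continuous_on_compose2[OF b]
        continuous_on_subset[OF F] continuous_intros) auto
  then show ?thesis by (simp add: split_def)
qed

lemma continuous_on_integral_param:
  fixes F :: "real \<Rightarrow> real \<Rightarrow> real"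
  assumes F: "continuous_on (S \<times> UNIV) (\<lambda>(t, x). F t x)" and b: "continuous_on UNIV b"
  shows "continuous_on S (\<lambda>t. integral {c..d} (\<lambda>x. F t x * b x))"
  using integral_continuous_on_param[of S c d "\<lambda>t x. F t x * b x"]
    continuous_on_pair_mult[OF F continuous_on_const[of _ 1] b, of "{c..d}"] by simp

text \<open>For one fixed \<open>\<psi>\<close> the problem is scalar in time: the weak derivative
  of the moment of \<open>f\<close> against \<open>\<psi>\<close> is the integral of
  \<open>J\<close> against \<open>deriv \<psi>\<close>. The latter is continuous in time, so the
  integrated identity holds at every \<open>t\<close> although the equation is known only at almost
  every time.\<close>

theorem weak_evolution:
  fixes f f' J :: "real \<Rightarrow> real \<Rightarrow> real"
  assumes T: "T > 0"
    and f: "continuous_on ({0..T} \<times> UNIV) (\<lambda>(t, x). f t x)"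
    and J: "continuous_on ({0..T} \<times> UNIV) (\<lambda>(t, x). J t x)"
    and f': "Linf_sobolev T m 2 f'" "weak_time_deriv T f f'"
    and eq: "AE t in lebesgue_on {0..T}. circle_weak_deriv 1 (J t) (\<lambda>x. - f' t x)"
    and \<psi>: "circle_test_fun \<psi>" and t: "t \<in> {0..T}"
  shows "integral {0..2 * pi} (\<lambda>x. f t x * \<psi> x) - integral {0..2 * pi} (\<lambda>x. f 0 x * \<psi> x)
       = integral {0..t} (\<lambda>s. integral {0..2 * pi} (\<lambda>x. J s x * deriv \<psi> x))"
proof -
  let ?I = "{0..2 * pi}"
  have \<psi>_smooth: "smooth \<psi>"
    using \<psi> by (simp add: circle_test_fun_def)
  have \<psi>_cont: "continuous_on S \<psi>" and d\<psi>_cont: "continuous_on S (deriv \<psi>)" for S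
    by (intro smooth_imp_continuous_on \<psi>_smooth smooth_deriv)+
  define \<mu> where "\<mu> = (\<lambda>t. integral ?I (\<lambda>x. f t x * \<psi> x))"
  define w where "w = (\<lambda>t. integral ?I (\<lambda>x. J t x * deriv \<psi> x))"
  define W where "W = (\<lambda>t. integral {0..t} w)"
  have \<mu>_cont: "continuous_on {0..T} \<mu>" and w_cont: "continuous_on {0..T} w"
    unfolding \<mu>_def w_def by (intro continuous_on_integral_param f J \<psi>_cont d\<psi>_cont)+
  have W: "(W has_real_derivative w t) (at t within {0..T})" if "t \<in> {0..T}" for t
    unfolding W_def by (rule integral_has_real_derivative[OF w_cont that])
  then have W_cont: "continuous_on {0..T} W"
    by (intro DERIV_continuous_on)
  obtain M where "AE t in lebesgue_on {0..T}. circle_sobolev m 2 (f' t) \<and> circle_sobolev_norm m 2 (f' t) \<le> M"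
    and f'_meas: "(\<lambda>(t, x). f' t x) \<in> borel_measurable (lebesgue_on ({0..T} \<times> UNIV))"
    using f'(1) by (auto simp: Linf_sobolev_def)
  then have f'_bound: "AE t in lebesgue. t \<in> {0..T} \<longrightarrow> set_integrable lebesgue ?I (f' t) \<and>
      (LINT x:?I|lebesgue. \<bar>f' t x\<bar>) \<le> 2 * pi + M\<^sup>2"
    unfolding AE_lebesgue_on_Icc by eventually_elim (auto intro: sobolev_norm_L1_bound)
  have eq': "AE t in lebesgue. t \<in> {0..T} \<longrightarrow> (LINT x:?I|lebesgue. f' t x * \<psi> x) = w t"
    using eq unfolding AE_lebesgue_on_Icc
  proof eventually_elim
    case (elim t)
    show ?case
    proof
      assume t: "t \<in> {0..T}"
      with elim \<psi> have "(LINT x:?I|lebesgue. J t x * deriv \<psi> x)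
          = - (LINT x:?I|lebesgue. - f' t x * \<psi> x)"
        by (auto simp: circle_weak_deriv_def)
      moreover have "(LINT x:?I|lebesgue. J t x * deriv \<psi> x) = w t"
        unfolding w_def
        by (intro LINT_continuous continuous_on_mult d\<psi>_cont continuous_on_slice[OF J t])
      moreover have "(LINT x:?I|lebesgue. - f' t x * \<psi> x) = - (LINT x:?I|lebesgue. f' t x * \<psi> x)"
        by (simp add: set_lebesgue_integral_def)
      ultimately show "(LINT x:?I|lebesgue. f' t x * \<psi> x) = w t"
        by linarith
    qed
  qed
  \<comment> \<open>Both \<open>\<mu>\<close> and \<open>W\<close>, paired with
    \<open>deriv \<eta>\<close>, give minus the integral of \<open>w * \<eta>\<close>:
    \<open>W\<close> by parts, \<open>\<mu>\<close> through the weak time derivative, Fubini's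
    theorem and the equation in \<open>x\<close>.\<close>
  have "\<mu> t - W t = \<mu> 0 - W 0"
  proof (rule time_du_Bois_Reymond[OF T _ _ t])
    show "continuous_on {0..T} (\<lambda>t. \<mu> t - W t)"
      by (intro continuous_intros \<mu>_cont W_cont)
    fix \<eta> assume \<eta>: "time_test_fun T \<eta>"
    then have \<eta>_smooth: "smooth \<eta>"
      by (simp add: time_test_fun_def)
    have \<eta>_cont: "continuous_on S \<eta>" and d\<eta>_cont: "continuous_on S (deriv \<eta>)" for S
      by (intro smooth_imp_continuous_on \<eta>_smooth smooth_deriv)+
    have "\<eta> 0 = 0" "\<eta> T = 0"
      using \<eta> closure_subset[of "{t. \<eta> t \<noteq> 0}"] by (auto simp: time_test_fun_def)
    have "((\<lambda>t. deriv \<eta> t * W t + w t * \<eta> t) has_integral \<eta> T * W T - \<eta> 0 * W 0) {0..T}"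
    proof (rule fundamental_theorem_of_calculus)
      fix t assume "t \<in> {0..T}"
      from DERIV_mult[OF has_field_derivative_at_within[OF smooth_imp_deriv[OF \<eta>_smooth]] W[OF this]]
      show "((\<lambda>t. \<eta> t * W t) has_vector_derivative deriv \<eta> t * W t + w t * \<eta> t) (at t within {0..T})"
        by (simp add: has_real_derivative_iff_has_vector_derivative)
    qed (use T in simp)
    moreover have "((\<lambda>t. deriv \<eta> t * W t + w t * \<eta> t) has_integral
        integral {0..T} (\<lambda>t. deriv \<eta> t * W t) + integral {0..T} (\<lambda>t. w t * \<eta> t)) {0..T}"
      by (intro has_integral_add integrable_integral integrable_continuous_real
          continuous_on_mult \<eta>_cont d\<eta>_cont W_cont w_cont)
    ultimately have "\<eta> T * W T - \<eta> 0 * W 0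
        = integral {0..T} (\<lambda>t. deriv \<eta> t * W t) + integral {0..T} (\<lambda>t. w t * \<eta> t)"
      by (rule has_integral_unique)
    then have parts: "integral {0..T} (\<lambda>t. deriv \<eta> t * W t) = - integral {0..T} (\<lambda>t. w t * \<eta> t)"
      using \<open>\<eta> 0 = 0\<close> \<open>\<eta> T = 0\<close> by simp
    obtain A where A: "\<And>t. t \<in> {0..T} \<Longrightarrow> \<bar>\<eta> t\<bar> \<le> A"
      using compact_imp_bounded[OF compact_continuous_image[OF \<eta>_cont compact_Icc[of 0 T]]]
      unfolding bounded_iff ball_simps real_norm_def by blast
    obtain B where B: "\<And>x. x \<in> ?I \<Longrightarrow> \<bar>\<psi> x\<bar> \<le> B"
      using compact_imp_bounded[OF compact_continuous_image[OF \<psi>_cont compact_Icc[of 0 "2 * pi"]]]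
      unfolding bounded_iff ball_simps real_norm_def by blast
    have AB: "A \<ge> 0" "B \<ge> 0"
      using A[of 0] B[of 0] T by (auto intro: order_trans[OF abs_ge_zero])
    have "continuous_on ({0..T} \<times> ?I) (\<lambda>(t, x). deriv \<eta> t * f t x * \<psi> x)"
      by (rule continuous_on_pair_mult[OF f d\<eta>_cont \<psi>_cont])
    then have "continuous_on (?I \<times> cbox 0 T) (\<lambda>(x, t). deriv \<eta> t * f t x * \<psi> x)"
      by (simp add: continuous_on_swap_args cbox_interval)
    from integral_continuous_on_param[OF this]
    have inner_cont: "continuous_on ?I (\<lambda>x. integral {0..T} (\<lambda>t. deriv \<eta> t * f t x * \<psi> x))"
      by (simp add: cbox_interval)
    have "integral {0..T} (\<lambda>t. deriv \<eta> t * \<mu> t)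
        = integral {0..T} (\<lambda>t. integral ?I (\<lambda>x. deriv \<eta> t * f t x * \<psi> x))"
      by (simp add: \<mu>_def mult.assoc)
    also have "\<dots> = integral ?I (\<lambda>x. integral {0..T} (\<lambda>t. deriv \<eta> t * f t x * \<psi> x))"
      using integral_swap_continuous[of 0 0 T "2 * pi" "\<lambda>t x. deriv \<eta> t * f t x * \<psi> x"]
        continuous_on_pair_mult[OF f d\<eta>_cont \<psi>_cont, of ?I] by (simp add: cbox_Pair_eq)
    also have "\<dots> = (LINT x:?I|lebesgue. integral {0..T} (\<lambda>t. deriv \<eta> t * f t x * \<psi> x))"
      by (rule LINT_continuous[OF inner_cont, symmetric])
    \<comment> \<open>The weak time derivative is an identity for almost every \<open>x\<close>,
      with a null set depending on \<open>\<eta>\<close>; integrating over \<open>x\<close> makes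
      this harmless.\<close>
    also have "\<dots> = (LINT x:?I|lebesgue. - (LINT t:{0..T}|lebesgue. \<eta> t * f' t x * \<psi> x))"
    proof -
      have 1: "integral {0..T} (\<lambda>t. deriv \<eta> t * f t x * \<psi> x)
          = (LINT t:{0..T}|lebesgue. deriv \<eta> t * f t x) * \<psi> x" for x
        using LINT_continuous[OF continuous_on_mult[OF d\<eta>_cont continuous_on_slice'[OF f]], of x]
        by simp
      have 2: "(LINT t:{0..T}|lebesgue. \<eta> t * f' t x * \<psi> x)
          = (LINT t:{0..T}|lebesgue. \<eta> t * f' t x) * \<psi> x" for x
        by simp
      have "AE x in lebesgue. (LINT t:{0..T}|lebesgue. deriv \<eta> t * f t x)
          = - (LINT t:{0..T}|lebesgue. \<eta> t * f' t x)"
        using f'(2) \<eta> by (simp add: weak_time_deriv_def time_test_fun_def)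
      then have AE: "AE x in lebesgue. integral {0..T} (\<lambda>t. deriv \<eta> t * f t x * \<psi> x)
          = - (LINT t:{0..T}|lebesgue. \<eta> t * f' t x * \<psi> x)"
        unfolding 1 2 by eventually_elim simp
      \<comment> \<open>Measurability in \<open>x\<close> is checked on the continuous side only;
        the time integral with \<open>f'\<close> inherits it from the equality almost
        everywhere.\<close>
      from absolutely_integrable_continuous_real[OF inner_cont]
      have meas: "(\<lambda>x. indicator ?I x *\<^sub>R integral {0..T} (\<lambda>t. deriv \<eta> t * f t x * \<psi> x))
          \<in> borel_measurable lebesgue"
        unfolding set_integrable_def by (rule borel_measurable_integrable)
      have AE': "AE x in lebesgue. indicator ?I x *\<^sub>R integral {0..T} (\<lambda>t. deriv \<eta> t * f t x * \<psi> x)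
          = indicator ?I x *\<^sub>R - (LINT t:{0..T}|lebesgue. \<eta> t * f' t x * \<psi> x)"
        using AE by eventually_elim (simp only:)
      show ?thesis
        unfolding set_lebesgue_integral_def[of _ ?I]
        by (rule integral_cong_AE[OF meas borel_measurable_AE[OF meas AE'] AE'])
    qed
    also have "\<dots> = - (LINT x:?I|lebesgue. LINT t:{0..T}|lebesgue. \<eta> t * f' t x * \<psi> x)"
      by (simp add: set_lebesgue_integral_def)
    also have "(LINT x:?I|lebesgue. LINT t:{0..T}|lebesgue. \<eta> t * f' t x * \<psi> x)
        = (LINT t:{0..T}|lebesgue. LINT x:?I|lebesgue. \<eta> t * f' t x * \<psi> x)"
    proof (rule Fubini_set_lebesgue_integral[symmetric])
      have S: "{0..T} \<times> ?I \<in> sets lebesgue"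
        using closed_Times[of "{0..T}" ?I] by auto
      have "(\<lambda>(t, x). f' t x) \<in> borel_measurable (lebesgue_on ({0..T} \<times> ?I))"
        by (rule measurable_restrict_mono[OF f'_meas]) auto
      moreover have "(\<lambda>z. \<eta> (fst z)) \<in> borel_measurable (lebesgue_on ({0..T} \<times> ?I))"
        "(\<lambda>z. \<psi> (snd z)) \<in> borel_measurable (lebesgue_on ({0..T} \<times> ?I))"
        by (intro continuous_imp_measurable_on_sets_lebesgue S continuous_on_compose2[OF \<eta>_cont[of UNIV]]
            continuous_on_compose2[OF \<psi>_cont[of UNIV]] continuous_intros; simp)+
      ultimately have "(\<lambda>z. \<eta> (fst z) * (case z of (t, x) \<Rightarrow> f' t x) * \<psi> (snd z))
          \<in> borel_measurable (lebesgue_on ({0..T} \<times> ?I))"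
        by (intro borel_measurable_times)
      then show "(\<lambda>(t, x). \<eta> t * f' t x * \<psi> x) \<in> borel_measurable (lebesgue_on ({0..T} \<times> ?I))"
        by (simp add: split_def)
      show "AE t in lebesgue. t \<in> {0..T} \<longrightarrow>
          set_integrable lebesgue ?I (\<lambda>x. \<eta> t * f' t x * \<psi> x) \<and>
          (LINT x:?I|lebesgue. \<bar>\<eta> t * f' t x * \<psi> x\<bar>) \<le> A * (2 * pi + M\<^sup>2) * B"
        using f'_bound
      proof eventually_elim
        case (elim t)
        show ?case
        proof (intro impI conjI)
          assume t: "t \<in> {0..T}"
          then have i: "set_integrable lebesgue ?I (f' t)"
            and le: "(LINT x:?I|lebesgue. \<bar>f' t x\<bar>) \<le> 2 * pi + M\<^sup>2"
            using elim by auto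
          show int: "set_integrable lebesgue ?I (\<lambda>x. \<eta> t * f' t x * \<psi> x)"
            by (intro set_integrable_mult_continuous set_integrable_mult_right i \<psi>_cont)
          have "(LINT x:?I|lebesgue. \<bar>\<eta> t * f' t x * \<psi> x\<bar>)
              \<le> (LINT x:?I|lebesgue. A * \<bar>f' t x\<bar> * B)"
          proof (rule set_integral_mono)
            show "set_integrable lebesgue ?I (\<lambda>x. A * \<bar>f' t x\<bar> * B)"
              by (intro set_integrable_mult_left set_integrable_mult_right set_integrable_abs i)
            show "\<bar>\<eta> t * f' t x * \<psi> x\<bar> \<le> A * \<bar>f' t x\<bar> * B" if "x \<in> ?I" for x
              unfolding abs_mult using A[OF t] B[OF that] AB by (intro mult_mono) auto
          qed (rule set_integrable_abs[OF int])
          also have "\<dots> = A * (LINT x:?I|lebesgue. \<bar>f' t x\<bar>) * B"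
            by simp
          also have "\<dots> \<le> A * (2 * pi + M\<^sup>2) * B"
            using le AB by (intro mult_right_mono mult_left_mono)
          finally show "(LINT x:?I|lebesgue. \<bar>\<eta> t * f' t x * \<psi> x\<bar>) \<le> A * (2 * pi + M\<^sup>2) * B" .
        qed
      qed
    qed
    also have "\<dots> = (LINT t:{0..T}|lebesgue. w t * \<eta> t)"
    proof -
      have meas: "(\<lambda>t. indicator {0..T} t *\<^sub>R (w t * \<eta> t)) \<in> borel_measurable lebesgue"
        using absolutely_integrable_continuous_real[OF continuous_on_mult[OF w_cont \<eta>_cont]]
        unfolding set_integrable_def by (rule borel_measurable_integrable)
      have AE: "AE t in lebesgue. indicator {0..T} t *\<^sub>R (w t * \<eta> t)
          = indicator {0..T} t *\<^sub>R (LINT x:?I|lebesgue. \<eta> t * f' t x * \<psi> x)"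
        using eq' by eventually_elim (auto simp: indicator_def mult.assoc)
      show ?thesis
        unfolding set_lebesgue_integral_def[of _ "{0..T}"]
        by (rule integral_cong_AE[OF meas borel_measurable_AE[OF meas AE] AE, symmetric])
    qed
    also have "\<dots> = integral {0..T} (\<lambda>t. w t * \<eta> t)"
      by (intro LINT_continuous continuous_on_mult w_cont \<eta>_cont)
    finally have \<mu>_eq: "integral {0..T} (\<lambda>t. deriv \<eta> t * \<mu> t) = - integral {0..T} (\<lambda>t. w t * \<eta> t)" .
    have "(LINT t:{0..T}|lebesgue. deriv \<eta> t * (\<mu> t - W t))
        = integral {0..T} (\<lambda>t. deriv \<eta> t * (\<mu> t - W t))"
      by (intro LINT_continuous continuous_on_mult continuous_on_diff d\<eta>_cont \<mu>_cont W_cont)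
    also have "\<dots> = integral {0..T} (\<lambda>t. deriv \<eta> t * \<mu> t) - integral {0..T} (\<lambda>t. deriv \<eta> t * W t)"
      unfolding right_diff_distrib
      by (intro integral_diff integrable_continuous_real continuous_on_mult d\<eta>_cont \<mu>_cont W_cont)
    finally show "(LINT t:{0..T}|lebesgue. deriv \<eta> t * (\<mu> t - W t)) = 0"
      unfolding \<mu>_eq parts by simp
  qed
  then show ?thesis
    by (simp add: \<mu>_def w_def W_def)
qed

section \<open>From moments to the distribution function\<close>

lemma circle_fun_int:
  assumes "circle_fun h"
  shows "h (x + 2 * pi * of_int n) = h x"
proof -
  have *: "h (x + 2 * pi * real m) = h x" for x m
  proof (induction m)
    case (Suc m)
    have "h (x + 2 * pi * real (Suc m)) = h ((x + 2 * pi * real m) + 2 * pi)"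
      by (simp add: algebra_simps)
    also have "\<dots> = h x"
      using assms Suc by (simp add: circle_fun_def)
    finally show ?case .
  qed simp
  show ?thesis
  proof (cases "n \<ge> 0")
    case True
    then show ?thesis using *[of x "nat n"] by simp
  next
    case False
    then show ?thesis using *[of "x + 2 * pi * of_int n" "nat (- n)"] by simp
  qed
qed

lemma period_representative:
  obtains y n where "y \<in> {0..<2 * pi}" "x = y + 2 * pi * of_int n"
proof
  show "x - 2 * pi * of_int \<lfloor>x / (2 * pi)\<rfloor> \<in> {0..<2 * pi}"
    using floor_divide_lower[of "2 * pi" x] floor_divide_upper[of "2 * pi" x]
    by (simp add: algebra_simps)
qed simp

text \<open>Integration by parts in \<open>x\<close> moves the derivative from \<open>F\<close> to
  the test function. The sum \<open>D\<close> of the increment of \<open>F\<close> and the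
  accumulated flux is then orthogonal to all derivatives of test functions, hence constant on a
  period.\<close>

theorem cdf_evolution:
  fixes f f' J F :: "real \<Rightarrow> real \<Rightarrow> real"
  assumes T: "T > 0"
    and f: "continuous_on ({0..T} \<times> UNIV) (\<lambda>(t, x). f t x)" "\<And>t. t \<in> {0..T} \<Longrightarrow> circle_fun (f t)"
    and J: "continuous_on ({0..T} \<times> UNIV) (\<lambda>(t, x). J t x)" "\<And>t. t \<in> {0..T} \<Longrightarrow> circle_fun (J t)"
    and f': "Linf_sobolev T m 2 f'" "weak_time_deriv T f f'"
    and eq: "AE t in lebesgue_on {0..T}. circle_weak_deriv 1 (J t) (\<lambda>x. - f' t x)"
    and F: "\<And>t x. t \<in> {0..T} \<Longrightarrow> (F t has_real_derivative f t x) (at x)"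
      "\<And>t. t \<in> {0..T} \<Longrightarrow> F t 0 = 0"
    and t: "t \<in> {0..T}"
  shows "F t (2 * pi) = F 0 (2 * pi)"
    and "F t x - F 0 x = integral {0..t} (\<lambda>s. J s 0) - integral {0..t} (\<lambda>s. J s x)"
proof -
  note evolution = weak_evolution[OF T f(1) J(1) f' eq _ t]
  have 0: "0 \<in> {0..T}"
    using T by simp
  have f_cont: "continuous_on S (f s)" if "s \<in> {0..T}" for S s
    by (rule continuous_on_slice[OF f(1) that])
  have F_int: "(f s has_integral F s (2 * pi)) {0..2 * pi}" if "s \<in> {0..T}" for s
    using antiderivative_has_integral[of "F s" "f s" 0 "2 * pi"] F that by simp
  have "deriv (\<lambda>_::real. 1 :: real) = (\<lambda>_. 0)"
    by (intro ext DERIV_imp_deriv DERIV_const)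
  \<comment> \<open>The constant test function has derivative 0, so the flux term vanishes and mass
    is conserved.\<close>
  with evolution[OF circle_test_fun_const[of 1]]
  have "integral {0..2 * pi} (f t) - integral {0..2 * pi} (f 0) = 0"
    by (simp only: mult_1_right mult_zero_right integral_0)
  then show mass: "F t (2 * pi) = F 0 (2 * pi)"
    unfolding integral_unique[OF F_int[OF t]] integral_unique[OF F_int[OF 0]] by simp
  define A where "A = (\<lambda>x. integral {0..t} (\<lambda>s. J s x))"
  have J_cont: "continuous_on (UNIV \<times> cbox 0 t) (\<lambda>(x, s). J s x)"
    using t by (intro continuous_on_swap_args[OF continuous_on_subset[OF J(1)]]) (auto simp: cbox_interval)
  have A_cont: "continuous_on S A" for S
    using continuous_on_subset[OF integral_continuous_on_param[OF J_cont], of S]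
    by (simp add: A_def cbox_interval)
  define D where "D = (\<lambda>x. F t x - F 0 x + A x)"
  have F_cont: "continuous_on S (F s)" if "s \<in> {0..T}" for S s
    using F(1)[OF that] by (intro DERIV_continuous_on) (rule has_field_derivative_at_within)
  have D_cont: "continuous_on S D" for S
    unfolding D_def by (intro continuous_intros F_cont t 0 A_cont)
  have D: "D y = D 0" if "y \<in> {0..2 * pi}" for y
  proof (rule circle_du_Bois_Reymond[OF D_cont _ that])
    fix \<psi> assume \<psi>: "circle_test_fun \<psi>"
    then have \<psi>_smooth: "smooth \<psi>" and \<psi>_per: "\<psi> (2 * pi) = \<psi> 0"
      using circle_fun_int[of \<psi> 0 1] by (auto simp: circle_test_fun_def)
    have \<psi>_cont: "continuous_on S \<psi>" and d\<psi>_cont: "continuous_on S (deriv \<psi>)" for S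
      by (intro smooth_imp_continuous_on \<psi>_smooth smooth_deriv)+
    have parts: "((\<lambda>x. f s x * \<psi> x + deriv \<psi> x * F s x) has_integral F s (2 * pi) * \<psi> 0) {0..2 * pi}"
      if s: "s \<in> {0..T}" for s
      using antiderivative_has_integral[OF DERIV_mult[OF F(1)[OF s] smooth_imp_deriv[OF \<psi>_smooth]],
          of 0 "2 * pi"] F(2)[OF s] \<psi>_per by simp
    have parts': "integral {0..2 * pi} (\<lambda>x. deriv \<psi> x * F s x)
        = F s (2 * pi) * \<psi> 0 - integral {0..2 * pi} (\<lambda>x. f s x * \<psi> x)" if s: "s \<in> {0..T}" for s
    proof -
      have "((\<lambda>x. f s x * \<psi> x + deriv \<psi> x * F s x) has_integral
          integral {0..2 * pi} (\<lambda>x. f s x * \<psi> x) + integral {0..2 * pi} (\<lambda>x. deriv \<psi> x * F s x))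
          {0..2 * pi}"
        by (intro has_integral_add integrable_integral integrable_continuous_real continuous_on_mult
            f_cont F_cont s \<psi>_cont d\<psi>_cont)
      from has_integral_unique[OF this parts[OF s]] show ?thesis by simp
    qed
    have "integral {0..2 * pi} (\<lambda>x. A x * deriv \<psi> x)
        = integral {0..2 * pi} (\<lambda>x. integral {0..t} (\<lambda>s. J s x * deriv \<psi> x))"
      by (simp add: A_def)
    also have "\<dots> = integral {0..t} (\<lambda>s. integral {0..2 * pi} (\<lambda>x. J s x * deriv \<psi> x))"
    proof -
      have "continuous_on ({0..T} \<times> {0..2 * pi}) (\<lambda>(s, x). 1 * J s x * deriv \<psi> x)"
        by (rule continuous_on_pair_mult[OF J(1) continuous_on_const d\<psi>_cont])
      then have "continuous_on ({0..t} \<times> {0..2 * pi}) (\<lambda>(s, x). J s x * deriv \<psi> x)"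
        using t by (auto elim!: continuous_on_subset)
      then show ?thesis
        using integral_swap_continuous[of 0 0 t "2 * pi" "\<lambda>s x. J s x * deriv \<psi> x"]
        by (simp add: cbox_Pair_eq)
    qed
    also have "\<dots> = integral {0..2 * pi} (\<lambda>x. f t x * \<psi> x) - integral {0..2 * pi} (\<lambda>x. f 0 x * \<psi> x)"
      by (rule evolution[OF \<psi>, symmetric])
    finally have A_int: "integral {0..2 * pi} (\<lambda>x. A x * deriv \<psi> x)
        = integral {0..2 * pi} (\<lambda>x. f t x * \<psi> x) - integral {0..2 * pi} (\<lambda>x. f 0 x * \<psi> x)" .
    have "((\<lambda>x. (deriv \<psi> x * F t x - deriv \<psi> x * F 0 x) + A x * deriv \<psi> x) has_integral
        (integral {0..2 * pi} (\<lambda>x. deriv \<psi> x * F t x) - integral {0..2 * pi} (\<lambda>x. deriv \<psi> x * F 0 x))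
        + integral {0..2 * pi} (\<lambda>x. A x * deriv \<psi> x)) {0..2 * pi}"
      by (intro has_integral_add has_integral_diff integrable_integral integrable_continuous_real
          continuous_on_mult F_cont t 0 A_cont d\<psi>_cont)
    moreover have "(\<lambda>x. (deriv \<psi> x * F t x - deriv \<psi> x * F 0 x) + A x * deriv \<psi> x)
        = (\<lambda>x. D x * deriv \<psi> x)"
      by (simp add: D_def algebra_simps)
    \<comment> \<open>The boundary terms \<open>F t (2 * pi) * \<psi> 0\<close> and
      \<open>F 0 (2 * pi) * \<psi> 0\<close> cancel by conservation of mass; the remaining terms
      cancel by \<open>A_int\<close>.\<close>
    ultimately have "integral {0..2 * pi} (\<lambda>x. D x * deriv \<psi> x) = 0"
      using parts'[OF t] parts'[OF 0] A_int mass by (simp add: integral_unique)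
    then show "(LINT x:{0..2 * pi}|lebesgue. D x * deriv \<psi> x) = 0"
      by (subst LINT_continuous) (intro continuous_on_mult D_cont d\<psi>_cont)+
  qed
  have F_shift: "F s (x + 2 * pi) = F s x + F s (2 * pi)" if s: "s \<in> {0..T}" for s x
    using primitive_shift_period[OF f(2)[OF s] F(1)[OF s]] F(2)[OF s] by simp
  have "integral {0..t} (\<lambda>s. J s (x + 2 * pi)) = integral {0..t} (\<lambda>s. J s x)" for x
    using J(2) t by (intro integral_cong) (auto simp: circle_fun_def)
  \<comment> \<open>Neither \<open>F t\<close> nor \<open>F 0\<close> is periodic, but both gain the
    same mass over a period. This carries constancy from one period to the whole line.\<close>
  then have "circle_fun D"
    by (simp add: circle_fun_def D_def A_def F_shift[OF t] F_shift[OF 0] mass)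
  moreover obtain y n where y: "y \<in> {0..<2 * pi}" "x = y + 2 * pi * of_int n"
    by (rule period_representative)
  ultimately have "D x = D y"
    by (simp add: circle_fun_int)
  also have "\<dots> = D 0"
    using y(1) by (intro D) simp
  finally have "D x = D 0" .
  then show "F t x - F 0 x = integral {0..t} (\<lambda>s. J s 0) - integral {0..t} (\<lambda>s. J s x)"
    using F(2)[OF t] F(2)[OF 0] by (simp add: D_def A_def)
qed

text \<open>The chain rule needs total differentiability of \<open>G\<close>, for which continuity
  of one partial derivative, here \<open>f\<close>, together with existence of the other is
  enough.\<close>

lemma has_derivative_along_line:
  fixes G f J :: "real \<Rightarrow> real \<Rightarrow> real"
  assumes f: "continuous_on (S \<times> UNIV) (\<lambda>(t, x). f t x)"
    and Gx: "\<And>t x. t \<in> S \<Longrightarrow> (G t has_real_derivative f t x) (at x)"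
    and Gt: "\<And>t x. t \<in> S \<Longrightarrow> ((\<lambda>s. G s x) has_real_derivative - J t x) (at t within S)"
    and r: "r \<in> S"
  shows "((\<lambda>s. G s (y + v * (s - a))) has_real_derivative
      f r (y + v * (r - a)) * v - J r (y + v * (r - a))) (at r within S)"
proof -
  define z where "z = y + v * (r - a)"
  have "((\<lambda>(t, x). G t x) has_derivative
      (\<lambda>(h, k). - J r z * h + blinfun_apply (blinfun_mult_right (f r z)) k)) (at (r, z) within S \<times> UNIV)"
  proof (rule has_derivative_partialsI)
    show "((\<lambda>t. G t z) has_derivative (\<lambda>h. - J r z * h)) (at r within S)"
      using Gt[OF r, of z] unfolding has_field_derivative_def .
    show "(G t has_derivative blinfun_apply (blinfun_mult_right (f t x))) (at x within UNIV)"
      if "t \<in> S" for t x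
      using Gx[OF that, of x] by (simp add: has_field_derivative_def blinfun_mult_right.rep_eq)
    have "continuous (at (r, z) within S \<times> UNIV) (\<lambda>(t, x). f t x)"
      using f r by (auto simp: continuous_on_eq_continuous_within)
    then have "continuous (at (r, z) within S \<times> UNIV) (\<lambda>p. blinfun_mult_right (case p of (t, x) \<Rightarrow> f t x))"
      by (rule bounded_linear.continuous[OF bounded_linear_blinfun_mult_right])
    then show "continuous (at (r, z) within S \<times> UNIV) (\<lambda>(t, x). blinfun_mult_right (f t x))"
      by (simp add: split_def)
  qed auto
  moreover have "((\<lambda>s. (s, y + v * (s - a))) has_derivative (\<lambda>h. (h, v * h))) (at r within S)"
    by (auto intro!: derivative_eq_intros)
  ultimately have "((\<lambda>(t, x). G t x) \<circ> (\<lambda>s. (s, y + v * (s - a))) has_derivative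
      (\<lambda>(h, k). - J r z * h + blinfun_apply (blinfun_mult_right (f r z)) k) \<circ> (\<lambda>h. (h, v * h)))
      (at r within S)"
    unfolding z_def by (intro diff_chain_within) (auto elim: has_derivative_subset)
  then have "((\<lambda>s. G s (y + v * (s - a))) has_derivative (\<lambda>h. - J r z * h + f r z * (v * h))) (at r within S)"
    by (simp add: comp_def blinfun_mult_right.rep_eq)
  then show ?thesis
    unfolding has_field_derivative_def z_def
    by (rule has_derivative_eq_rhs) (simp add: fun_eq_iff algebra_simps)
qed

section \<open>Level curves of a transported potential\<close>

lemma continuous_on_pairE:
  fixes F :: "real \<Rightarrow> real \<Rightarrow> real"
  assumes F: "continuous_on (S \<times> UNIV) (\<lambda>(t, x). F t x)" and t: "t \<in> S" and e: "e > 0"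
  obtains d where "d > 0"
    "\<And>s y. s \<in> S \<Longrightarrow> dist (s, y) (t, x) < d \<Longrightarrow> dist (F s y) (F t x) < e"
proof -
  have "(t, x) \<in> S \<times> UNIV"
    using t by simp
  with F e obtain d where "d > 0"
    "\<forall>z\<in>S \<times> UNIV. dist z (t, x) < d \<longrightarrow>
      dist (case z of (t, x) \<Rightarrow> F t x) (case (t, x) of (t, x) \<Rightarrow> F t x) < e"
    unfolding continuous_on_iff by blast
  then show ?thesis
    by (intro that[of d]) auto
qed

text \<open>Below, \<open>G\<close> is constant along the flow of \<open>u\<close>, so its values on two sides of a straight line
  are compared by the sign of the difference between the slope of the line and \<open>u\<close>. This uses
  \<open>f \<ge> 0\<close> only and replaces the implicit function theorem at the zeros of \<open>f\<close>.\<close>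

locale transport_potential =
  fixes T :: real and f u G :: "real \<Rightarrow> real \<Rightarrow> real"
  assumes T_pos: "T > 0"
    and f_cont: "continuous_on ({0..T} \<times> UNIV) (\<lambda>(t, x). f t x)"
    and u_cont: "continuous_on ({0..T} \<times> UNIV) (\<lambda>(t, x). u t x)"
    and u_bounded: "\<exists>B. \<forall>t\<in>{0..T}. \<forall>x. \<bar>u t x\<bar> \<le> B"
    and f_pos_dense: "\<And>t1 t2 x1 x2. 0 \<le> t1 \<Longrightarrow> t1 < t2 \<Longrightarrow> t2 \<le> T \<Longrightarrow> x1 < x2 \<Longrightarrow>
      \<exists>t\<in>{t1..t2}. \<exists>x\<in>{x1..x2}. f t x > 0"
    and G_x: "\<And>t x. t \<in> {0..T} \<Longrightarrow> (G t has_real_derivative f t x) (at x)"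
    and G_t: "\<And>t x. t \<in> {0..T} \<Longrightarrow>
      ((\<lambda>s. G s x) has_real_derivative - (f t x * u t x)) (at t within {0..T})"
begin

text \<open>By continuity a negative value would persist on a whole box, and every box contains a
  point where \<open>f\<close> is positive.\<close>

lemma f_nonneg:
  assumes t: "t \<in> {0..T}"
  shows "f t x \<ge> 0"
proof (rule ccontr)
  assume "\<not> f t x \<ge> 0"
  then have neg: "f t x < 0" by simp
  obtain d where d: "d > 0"
    and near: "\<And>s y. s \<in> {0..T} \<Longrightarrow> dist (s, y) (t, x) < d \<Longrightarrow> dist (f s y) (f t x) < - f t x"
    using continuous_on_pairE[OF f_cont t, of "- f t x"] neg by auto
  define t1 t2 where "t1 = max 0 (t - d / 3)" and "t2 = min T (t + d / 3)"
  have "0 \<le> t1" "t1 < t2" "t2 \<le> T"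
    using d t T_pos by (auto simp: t1_def t2_def)
  from f_pos_dense[OF this, of "x - d / 3" "x + d / 3"] d
  obtain s y where sy: "s \<in> {t1..t2}" "y \<in> {x - d / 3..x + d / 3}" "f s y > 0"
    by auto
  have "dist (s, y) (t, x) \<le> \<bar>s - t\<bar> + \<bar>y - x\<bar>"
    using sqrt_sum_squares_le_sum_abs[of "s - t" "y - x"] by (simp add: dist_Pair_Pair dist_real_def)
  also have "\<dots> \<le> d / 3 + d / 3"
    using sy(1,2) d by (intro add_mono abs_leI) (auto simp: t1_def t2_def)
  also have "\<dots> < d"
    using d by simp
  finally have "dist (f s y) (f t x) < - f t x"
    using sy(1) t by (intro near) (auto simp: t1_def t2_def)
  then show False
    using sy(3) by (simp add: dist_real_def)
qed

lemma G_mono: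
  assumes "t \<in> {0..T}" "x \<le> y"
  shows "G t x \<le> G t y"
  using assms(2) by (rule DERIV_nonneg_imp_nondecreasing) (use G_x f_nonneg assms(1) in blast)

lemma G_line:
  assumes "r \<in> {0..T}"
  shows "((\<lambda>s. G s (y + v * (s - a))) has_real_derivative
      f r (y + v * (r - a)) * (v - u r (y + v * (r - a)))) (at r within {0..T})"
  using has_derivative_along_line[OF f_cont G_x G_t assms, of y v a] by (simp add: right_diff_distrib)

lemma G_line_le:
  assumes "s \<le> t" "s \<in> {0..T}" "t \<in> {0..T}"
    and v: "\<And>r. r \<in> {s..t} \<Longrightarrow> u r (y + v * (r - a)) \<le> v"
  shows "G s (y + v * (s - a)) \<le> G t (y + v * (t - a))"
  using assms(1)
proof (rule DERIV_nonneg_imp_increasing_open)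
  show "continuous_on {s..t} (\<lambda>r. G r (y + v * (r - a)))"
    by (rule continuous_on_subset[OF DERIV_continuous_on[OF G_line]]) (use assms(2,3) in auto)
  fix r assume r: "s < r" "r < t"
  have "f r (y + v * (r - a)) * (v - u r (y + v * (r - a))) \<ge> 0"
    using f_nonneg v[of r] r assms(2,3) by auto
  moreover have "((\<lambda>r. G r (y + v * (r - a))) has_real_derivative
      f r (y + v * (r - a)) * (v - u r (y + v * (r - a)))) (at r)"
    using G_line[of r y v a] r assms(2,3) by (simp add: at_within_Icc_at)
  ultimately show "\<exists>D. ((\<lambda>r. G r (y + v * (r - a))) has_real_derivative D) (at r) \<and> D \<ge> 0"
    by blast
qed

lemma G_line_ge:
  assumes "s \<le> t" "s \<in> {0..T}" "t \<in> {0..T}"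
    and v: "\<And>r. r \<in> {s..t} \<Longrightarrow> v \<le> u r (y + v * (r - a))"
  shows "G t (y + v * (t - a)) \<le> G s (y + v * (s - a))"
  using assms(1)
proof (rule DERIV_nonpos_imp_decreasing_open)
  show "continuous_on {s..t} (\<lambda>r. G r (y + v * (r - a)))"
    by (rule continuous_on_subset[OF DERIV_continuous_on[OF G_line]]) (use assms(2,3) in auto)
  fix r assume r: "s < r" "r < t"
  have "f r (y + v * (r - a)) * (v - u r (y + v * (r - a))) \<le> 0"
    using f_nonneg v[of r] r assms(2,3) by (auto simp: mult_le_0_iff)
  moreover have "((\<lambda>r. G r (y + v * (r - a))) has_real_derivative
      f r (y + v * (r - a)) * (v - u r (y + v * (r - a)))) (at r)"
    using G_line[of r y v a] r assms(2,3) by (simp add: at_within_Icc_at)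
  ultimately show "\<exists>D. ((\<lambda>r. G r (y + v * (r - a))) has_real_derivative D) (at r) \<and> D \<le> 0"
    by blast
qed

text \<open>The lines of slopes \<open>B\<close> and \<open>- B\<close> through
  \<open>(s, x)\<close> bound the propagation of values of \<open>G\<close>. For
  \<open>r < s\<close> they are followed backwards and exchange their roles.\<close>

lemma G_finite_speed:
  assumes B: "\<And>t x. t \<in> {0..T} \<Longrightarrow> \<bar>u t x\<bar> \<le> B" and rs: "r \<in> {0..T}" "s \<in> {0..T}"
  shows "G s x \<le> G r (x + B * \<bar>r - s\<bar>)" "G r (x - B * \<bar>r - s\<bar>) \<le> G s x"
proof -
  have "u q z \<le> B" "- B \<le> u q z" if "q \<in> {0..T}" for q z
    using B[OF that, of z] by (auto simp: abs_le_iff)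
  then have u: "u q z \<le> B" "- B \<le> u q z" if "q \<in> {r..s} \<union> {s..r}" for q z
    using that rs by auto
  show "G s x \<le> G r (x + B * \<bar>r - s\<bar>)"
  proof (cases "s \<le> r")
    case True
    then show ?thesis
      using G_line_le[OF True rs(2,1), of x B s] u by simp
  next
    case False
    then show ?thesis
      using G_line_ge[of r s "- B" x s] rs u by (simp add: algebra_simps)
  qed
  show "G r (x - B * \<bar>r - s\<bar>) \<le> G s x"
  proof (cases "s \<le> r")
    case True
    then show ?thesis
      using G_line_ge[OF True rs(2,1), of "- B" x s] u by simp
  next
    case False
    then show ?thesis
      using G_line_le[of r s x B s] rs u by (simp add: algebra_simps)
  qed
qed

text \<open>A vacuum interval at one time would persist, shrinking at bounded speed, over a time interval
  of positive length.\<close>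

theorem G_strict_mono:
  assumes s: "s \<in> {0..T}" and "x < y"
  shows "G s x < G s y"
proof (rule ccontr)
  assume "\<not> G s x < G s y"
  then have le: "G s y \<le> G s x" by simp
  obtain B0 where B0: "\<And>t x. t \<in> {0..T} \<Longrightarrow> \<bar>u t x\<bar> \<le> B0"
    using u_bounded by blast
  define B where "B = max B0 1"
  have B: "\<bar>u t x\<bar> \<le> B" if "t \<in> {0..T}" for t x
    using B0[OF that, of x] by (simp add: B_def)
  \<comment> \<open>In time \<open>d\<close> a signal of speed \<open>B\<close> covers a third of
    \<open>y - x\<close>, so the middle third stays a vacuum at all times within \<open>d\<close> of
    \<open>s\<close>.\<close>
  define d where "d = (y - x) / (3 * B)"
  have d: "d > 0" "B * d = (y - x) / 3" and "B > 0"
    using \<open>x < y\<close> by (auto simp: d_def B_def)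
  define t1 t2 where "t1 = max 0 (s - d)" and "t2 = min T (s + d)"
  have "0 \<le> t1" "t1 < t2" "t2 \<le> T"
    using d(1) s T_pos by (auto simp: t1_def t2_def)
  \<comment> \<open>In units of this tenth of the length, the surviving third runs from 10/3 to
    20/3. The point with \<open>f > 0\<close> is sought between 4 and 6, strictly inside, so that
    \<open>G r\<close> is constant around it.\<close>
  define h where "h = (y - x) / 10"
  have h: "h > 0"
    using \<open>x < y\<close> by (simp add: h_def)
  obtain r z where r: "r \<in> {t1..t2}" and z: "z \<in> {x + 4 * h..x + 6 * h}" and pos: "f r z > 0"
    using f_pos_dense[OF \<open>0 \<le> t1\<close> \<open>t1 < t2\<close> \<open>t2 \<le> T\<close>, of "x + 4 * h" "x + 6 * h"] h by auto
  have rT: "r \<in> {0..T}"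
    using r by (auto simp: t1_def t2_def)
  have "B * \<bar>r - s\<bar> \<le> B * d"
    using r \<open>B > 0\<close> by (intro mult_left_mono) (auto simp: t1_def t2_def abs_le_iff)
  then have Bd: "B * \<bar>r - s\<bar> \<le> (y - x) / 3"
    using d(2) by simp
  have yx: "y = x + 10 * h"
    by (simp add: h_def field_simps)
  \<comment> \<open>The two speed bounds carry the flatness of \<open>G s\<close> to time
    \<open>r\<close>: the value at the right end of the middle third is at most the value at its
    left end.\<close>
  have "G r (x + (20/3) * h) \<le> G r (y - B * \<bar>r - s\<bar>)"
    using Bd by (intro G_mono[OF rT]) (simp add: yx)
  also have "\<dots> \<le> G s y"
    by (rule G_finite_speed(2)[OF B rT s])
  also have "\<dots> \<le> G r (x + B * \<bar>r - s\<bar>)"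
    using le G_finite_speed(1)[OF B rT s, of x] by simp
  also have "\<dots> \<le> G r (x + (10/3) * h)"
    using Bd by (intro G_mono[OF rT]) (simp add: yx)
  finally have flat: "G r (x + (20/3) * h) \<le> G r (x + (10/3) * h)" .
  have const: "G r q = G r (x + (10/3) * h)" if "q \<in> {x + (10/3) * h<..<x + (20/3) * h}" for q
    using G_mono[OF rT, of "x + (10/3) * h" q] G_mono[OF rT, of q "x + (20/3) * h"] flat that by simp
  have "(G r has_real_derivative 0) (at z)"
    by (rule has_field_derivative_transform_within_open[of "\<lambda>_. G r (x + (10/3) * h)" _ _
          "{x + (10/3) * h<..<x + (20/3) * h}"]) (use z h const in auto)
  with G_x[OF rT, of z] pos show False
    using DERIV_unique by fastforce
qed

text \<open>\<open>\<gamma>\<close> is not assumed continuous. The lines of slopes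
  \<open>b + e\<close> and \<open>b - e\<close> through \<open>(t, \<gamma> t)\<close> confine it to
  a double cone near \<open>t\<close>, and this is already the estimate that defines the
  derivative.\<close>

theorem level_curve_derivative:
  assumes \<gamma>: "\<And>s. s \<in> {0..T} \<Longrightarrow> G s (\<gamma> s) = \<xi>" and t: "t \<in> {0..T}"
  shows "(\<gamma> has_real_derivative u t (\<gamma> t)) (at t within {0..T})"
  unfolding has_field_derivative_def has_derivative_within_alt
proof (intro conjI allI impI)
  show "bounded_linear ((*) (u t (\<gamma> t)))"
    by (rule bounded_linear_mult_right)
  fix e :: real assume e: "e > 0"
  define x where "x = \<gamma> t"
  define b where "b = u t x"
  obtain d where d: "d > 0"
    and near: "\<And>s y. s \<in> {0..T} \<Longrightarrow> dist (s, y) (t, x) < d \<Longrightarrow> dist (u s y) b < e"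
    unfolding b_def using continuous_on_pairE[OF u_cont t e] by blast
  \<comment> \<open>On a line of slope at most \<open>\<bar>b\<bar> + e\<close> the distance from
    \<open>(t, x)\<close> is at most \<open>K * \<bar>r - t\<bar>\<close>, so the line stays where
    \<open>u\<close> is within \<open>e\<close> of \<open>b\<close> as long as
    \<open>\<bar>r - t\<bar> < d / K\<close>.\<close>
  define K where "K = 1 + \<bar>b\<bar> + e"
  have K: "K > 0"
    using e by (simp add: K_def)
  have slope: "b - e \<le> u r (x + v * (r - t))" "u r (x + v * (r - t)) \<le> b + e"
    if r: "r \<in> {0..T}" "\<bar>r - t\<bar> < d / K" and v: "\<bar>v\<bar> \<le> \<bar>b\<bar> + e" for r v
  proof -
    have "dist (r, x + v * (r - t)) (t, x) \<le> \<bar>r - t\<bar> + \<bar>v * (r - t)\<bar>"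
      using sqrt_sum_squares_le_sum_abs[of "r - t" "v * (r - t)"]
      by (simp add: dist_Pair_Pair dist_real_def)
    also have "\<dots> = (1 + \<bar>v\<bar>) * \<bar>r - t\<bar>"
      unfolding abs_mult by (simp add: distrib_right)
    also have "\<dots> \<le> K * \<bar>r - t\<bar>"
      using v by (intro mult_right_mono) (auto simp: K_def)
    also have "\<dots> < d"
      using r(2) K by (simp add: field_simps)
    finally have "dist (u r (x + v * (r - t))) b < e"
      by (rule near[OF r(1)])
    then show "b - e \<le> u r (x + v * (r - t))" "u r (x + v * (r - t)) \<le> b + e"
      by (auto simp: dist_real_def abs_less_iff)
  qed
  have v: "\<bar>b + e\<bar> \<le> \<bar>b\<bar> + e" "\<bar>b - e\<bar> \<le> \<bar>b\<bar> + e"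
    using e by auto
  have inverse_mono: "p \<le> q" if "s \<in> {0..T}" "G s p \<le> G s q" for s p q
    using G_strict_mono[OF that(1), of q p] that(2) by (cases "q < p") auto
  show "\<exists>d>0. \<forall>s\<in>{0..T}. norm (s - t) < d \<longrightarrow>
      norm (\<gamma> s - \<gamma> t - u t (\<gamma> t) * (s - t)) \<le> e * norm (s - t)"
  proof (intro exI[of _ "d / K"] conjI ballI impI)
    show "d / K > 0"
      using d K by simp
    fix s assume s: "s \<in> {0..T}" "norm (s - t) < d / K"
    have "\<bar>\<gamma> s - x - b * (s - t)\<bar> \<le> e * \<bar>s - t\<bar>"
    proof (cases "t \<le> s")
      case True
      have r: "r \<in> {0..T}" "\<bar>r - t\<bar> < d / K" if "r \<in> {t..s}" for r
        using that s t by auto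
      have "G t (x + (b + e) * (t - t)) \<le> G s (x + (b + e) * (s - t))"
        using slope(2)[OF r v(1)] by (intro G_line_le True t s)
      then have "\<gamma> s \<le> x + (b + e) * (s - t)"
        using \<gamma>[OF s(1)] \<gamma>[OF t] by (simp add: x_def inverse_mono[OF s(1)])
      moreover have "G s (x + (b - e) * (s - t)) \<le> G t (x + (b - e) * (t - t))"
        using slope(1)[OF r v(2)] by (intro G_line_ge True t s)
      then have "x + (b - e) * (s - t) \<le> \<gamma> s"
        using \<gamma>[OF s(1)] \<gamma>[OF t] by (simp add: x_def inverse_mono[OF s(1)])
      ultimately show ?thesis
        using True by (simp add: abs_le_iff algebra_simps)
    next
      case False
      then have st: "s \<le> t" by simp
      have r: "r \<in> {0..T}" "\<bar>r - t\<bar> < d / K" if "r \<in> {s..t}" for r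
        using that s t by auto
      \<comment> \<open>As \<open>s - t \<le> 0\<close>, the steeper line now lies below, and it
        bounds \<open>\<gamma> s\<close> from below.\<close>
      have "G s (x + (b + e) * (s - t)) \<le> G t (x + (b + e) * (t - t))"
        using slope(2)[OF r v(1)] by (intro G_line_le st t s)
      then have "x + (b + e) * (s - t) \<le> \<gamma> s"
        using \<gamma>[OF s(1)] \<gamma>[OF t] by (simp add: x_def inverse_mono[OF s(1)])
      moreover have "G t (x + (b - e) * (t - t)) \<le> G s (x + (b - e) * (s - t))"
        using slope(1)[OF r v(2)] by (intro G_line_ge st t s)
      then have "\<gamma> s \<le> x + (b - e) * (s - t)"
        using \<gamma>[OF s(1)] \<gamma>[OF t] by (simp add: x_def inverse_mono[OF s(1)])
      ultimately show ?thesis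
        using st by (simp add: abs_le_iff algebra_simps)
    qed
    then show "norm (\<gamma> s - \<gamma> t - u t (\<gamma> t) * (s - t)) \<le> e * norm (s - t)"
      by (simp add: x_def b_def)
  qed
qed

end

section \<open>The velocity as a convolution\<close>

lemma integral_shift_period:
  fixes h :: "real \<Rightarrow> real"
  assumes h: "circle_fun h" and int: "h absolutely_integrable_on {a..b}"
  shows "integral {a + 2 * pi * of_int n..b + 2 * pi * of_int n} h = integral {a..b} h"
proof -
  let ?g = "\<lambda>x. x + 2 * pi * of_int n"
  have "((\<lambda>x. \<bar>1\<bar> * h (?g x)) absolutely_integrable_on {a..b} \<and>
      integral {a..b} (\<lambda>x. \<bar>1\<bar> * h (?g x)) = integral {a..b} h) \<longleftrightarrow>
    (h absolutely_integrable_on (?g ` {a..b}) \<and> integral (?g ` {a..b}) h = integral {a..b} h)"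
    by (rule has_absolute_integral_change_of_variables_1') (auto intro!: derivative_eq_intros inj_onI)
  then show ?thesis
    using int by (simp add: circle_fun_int[OF h] image_add_atLeastAtMost')
qed

lemma integral_period:
  fixes h :: "real \<Rightarrow> real"
  assumes h: "circle_fun h" and int: "\<And>a b. h absolutely_integrable_on {a..b}"
  shows "integral {c..c + 2 * pi} h = integral {0..2 * pi} h"
proof -
  obtain y n where y: "y \<in> {0..<2 * pi}" "c = y + 2 * pi * of_int n"
    by (rule period_representative)
  have int': "h integrable_on {a..b}" for a b
    using int set_lebesgue_integral_eq_integral(1) by blast
  have "integral {c..c + 2 * pi} h = integral {y..y + 2 * pi} h"
    using integral_shift_period[OF h int, of y n "y + 2 * pi"] y(2) by (simp add: algebra_simps)
  also have "\<dots> = integral {y..2 * pi} h + integral {2 * pi..y + 2 * pi} h"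
    using y(1) by (intro Henstock_Kurzweil_Integration.integral_combine[symmetric] int') auto
  also have "integral {2 * pi..y + 2 * pi} h = integral {0..y} h"
    using integral_shift_period[OF h int, of 0 1 y] by simp
  also have "integral {y..2 * pi} h + integral {0..y} h = integral {0..2 * pi} h"
    using y(1) Henstock_Kurzweil_Integration.integral_combine[of 0 y "2 * pi" h] int' by auto
  finally show ?thesis .
qed

locale bounded_kernel =
  fixes K :: "real \<Rightarrow> real" and M :: real
  assumes K_per: "circle_fun K"
    and K_meas: "K \<in> borel_measurable lebesgue"
    and K_bound: "AE x in lebesgue. \<bar>K x\<bar> \<le> M"
begin

lemma K_integrable: "K absolutely_integrable_on {a..b}"
proof (rule set_integrable_bound)
  show "(\<lambda>_. M) absolutely_integrable_on {a..b}"
    by (intro absolutely_integrable_continuous_real continuous_on_const)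
  show "set_borel_measurable lebesgue {a..b} K"
    unfolding set_borel_measurable_def
    by (intro borel_measurable_scaleR borel_measurable_indicator K_meas) auto
  show "AE x in lebesgue. x \<in> {a..b} \<longrightarrow> norm (K x) \<le> norm M"
    using K_bound by eventually_elim auto
qed

lemma convolution_change_of_variables:
  assumes \<rho>: "continuous_on UNIV \<rho>"
  shows "(\<lambda>y. K (x - y) * \<rho> y) absolutely_integrable_on {a..b}"
    and "integral {a..b} (\<lambda>y. K (x - y) * \<rho> y) = integral {x - b..x - a} (\<lambda>z. K z * \<rho> (x - z))"
proof -
  let ?h = "\<lambda>z. K z * \<rho> (x - z)"
  let ?I = "integral {x - b..x - a} ?h"
  have "((\<lambda>y. \<bar>- 1\<bar> * ?h (x - y)) absolutely_integrable_on {a..b} \<and>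
      integral {a..b} (\<lambda>y. \<bar>- 1\<bar> * ?h (x - y)) = ?I) \<longleftrightarrow>
    (?h absolutely_integrable_on ((\<lambda>y. x - y) ` {a..b}) \<and> integral ((\<lambda>y. x - y) ` {a..b}) ?h = ?I)"
    by (rule has_absolute_integral_change_of_variables_1') (auto intro!: derivative_eq_intros inj_onI)
  moreover have "?h absolutely_integrable_on {x - b..x - a}"
    by (intro set_integrable_mult_continuous K_integrable continuous_on_compose2[OF \<rho>] continuous_intros) simp
  ultimately show "(\<lambda>y. K (x - y) * \<rho> y) absolutely_integrable_on {a..b}"
    "integral {a..b} (\<lambda>y. K (x - y) * \<rho> y) = ?I"
    by (simp_all add: image_diff_atLeastAtMost)
qed

text \<open>The first form puts the dependence on \<open>x\<close> into the density, which gives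
  continuity. The second allows an arbitrary period, to be matched with the one on which the
  quantile substitution takes place.\<close>

lemma velocity_eq:
  assumes "\<And>x y. \<phi> x y = K (x - y)" and \<rho>: "continuous_on UNIV \<rho>" "circle_fun \<rho>"
  shows "velocity \<phi> \<rho> x = integral {0..2 * pi} (\<lambda>z. K z * \<rho> (x - z))"
    and "velocity \<phi> \<rho> x = integral {c..c + 2 * pi} (\<lambda>y. K (x - y) * \<rho> y)"
proof -
  have 1: "velocity \<phi> \<rho> x = integral {0..2 * pi} (\<lambda>y. K (x - y) * \<rho> y)"
    unfolding velocity_def assms(1)
    by (rule set_lebesgue_integral_eq_integral(2)[OF convolution_change_of_variables(1)[OF \<rho>(1)]])
  have \<rho>': "\<rho> (y + 2 * pi * of_int n) = \<rho> y" for y n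
    by (rule circle_fun_int[OF \<rho>(2)])
  have K': "K (y + 2 * pi * of_int n) = K y" for y n
    by (rule circle_fun_int[OF K_per])
  have "circle_fun (\<lambda>y. K (x - y) * \<rho> y)"
    unfolding circle_fun_def
  proof
    fix y
    show "K (x - (y + 2 * pi)) * \<rho> (y + 2 * pi) = K (x - y) * \<rho> y"
      using \<rho>'[of y 1] K'[of "x - y" "-1"] by (simp add: algebra_simps)
  qed
  from integral_period[OF this convolution_change_of_variables(1)[OF \<rho>(1)]]
  show "velocity \<phi> \<rho> x = integral {c..c + 2 * pi} (\<lambda>y. K (x - y) * \<rho> y)"
    unfolding 1 by simp
  have "(\<lambda>z. K z * \<rho> (x - z)) absolutely_integrable_on {a..b}" for a b
    by (intro set_integrable_mult_continuous K_integrable continuous_on_compose2[OF \<rho>(1)] continuous_intros) simp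
  moreover have "circle_fun (\<lambda>z. K z * \<rho> (x - z))"
    unfolding circle_fun_def
  proof
    fix z
    show "K (z + 2 * pi) * \<rho> (x - (z + 2 * pi)) = K z * \<rho> (x - z)"
      using \<rho>'[of "x - z" "-1"] K'[of z 1] by (simp add: algebra_simps)
  qed
  ultimately have "integral {x - 2 * pi..x - 2 * pi + 2 * pi} (\<lambda>z. K z * \<rho> (x - z))
      = integral {0..2 * pi} (\<lambda>z. K z * \<rho> (x - z))"
    by (intro integral_period)
  then show "velocity \<phi> \<rho> x = integral {0..2 * pi} (\<lambda>z. K z * \<rho> (x - z))"
    unfolding 1 convolution_change_of_variables(2)[OF \<rho>(1)] by simp
qed

lemma kernel_integral_bound:
  assumes k: "continuous_on {a..b} k"
  shows "\<bar>integral {a..b} (\<lambda>z. K z * k z)\<bar> \<le> M * integral {a..b} (\<lambda>z. \<bar>k z\<bar>)"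
proof -
  have i: "(\<lambda>z. K z * k z) absolutely_integrable_on {a..b}"
    by (rule set_integrable_mult_continuous[OF K_integrable k])
  have c: "continuous_on {a..b} (\<lambda>z. M * \<bar>k z\<bar>)"
    by (intro continuous_intros k)
  have "\<bar>LINT z:{a..b}|lebesgue. K z * k z\<bar> \<le> (LINT z:{a..b}|lebesgue. M * \<bar>k z\<bar>)"
    unfolding set_lebesgue_integral_def
  proof (rule order_trans[OF integral_abs_bound integral_mono_AE])
    show "integrable lebesgue (\<lambda>z. \<bar>indicator {a..b} z *\<^sub>R (K z * k z)\<bar>)"
      using i by (simp add: set_integrable_def)
    show "integrable lebesgue (\<lambda>z. indicator {a..b} z *\<^sub>R (M * \<bar>k z\<bar>))"
      using absolutely_integrable_continuous_real[OF c] by (simp add: set_integrable_def)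
    show "AE z in lebesgue. \<bar>indicator {a..b} z *\<^sub>R (K z * k z)\<bar> \<le> indicator {a..b} z *\<^sub>R (M * \<bar>k z\<bar>)"
      using K_bound by eventually_elim (auto simp: indicator_def abs_mult intro: mult_right_mono)
  qed
  then show ?thesis
    unfolding set_lebesgue_integral_eq_integral(2)[OF i] LINT_continuous[OF c] by simp
qed

text \<open>\<open>K\<close> may be discontinuous. After the substitution only \<open>f\<close>
  depends on \<open>(t, x)\<close>, and its reflected translates vary continuously in the mean; the
  kernel enters through its bound \<open>M\<close> alone.\<close>

lemma velocity_continuous:
  fixes f :: "real \<Rightarrow> real \<Rightarrow> real"
  assumes \<phi>: "\<And>x y. \<phi> x y = K (x - y)"
    and f: "continuous_on (S \<times> UNIV) (\<lambda>(t, x). f t x)" "\<And>t. t \<in> S \<Longrightarrow> circle_fun (f t)"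
  shows "continuous_on (S \<times> UNIV) (\<lambda>(t, x). velocity \<phi> (f t) x)"
  unfolding continuous_on_def
proof
  fix p assume p: "p \<in> S \<times> (UNIV :: real set)"
  let ?v = "\<lambda>p. velocity \<phi> (f (fst p)) (snd p)"
  let ?k = "\<lambda>p z. f (fst p) (snd p - z)"
  define N where "N = (\<lambda>q. integral {0..2 * pi} (\<lambda>z. \<bar>?k q z - ?k p z\<bar>))"
  have kp: "continuous_on X (?k q)" if "q \<in> S \<times> UNIV" for q X
  proof -
    have "continuous_on UNIV (f (fst q))"
      using that by (intro continuous_on_slice[OF f(1)]) auto
    then show ?thesis
      by (rule continuous_on_compose2) (auto intro!: continuous_intros)
  qed
  have k_joint: "continuous_on ((S \<times> UNIV) \<times> cbox 0 (2 * pi)) (\<lambda>(q, z). ?k q z)"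
  proof -
    have "continuous_on ((S \<times> UNIV) \<times> cbox 0 (2 * pi))
        (\<lambda>w. (\<lambda>(t, x). f t x) (fst (fst w), snd (fst w) - snd w))"
      by (rule continuous_on_compose2[OF f(1)]) (auto intro!: continuous_intros)
    then show ?thesis by (simp add: split_def)
  qed
  have "continuous_on ((S \<times> UNIV) \<times> cbox 0 (2 * pi)) (\<lambda>w. \<bar>(case w of (q, z) \<Rightarrow> ?k q z) - ?k p (snd w)\<bar>)"
    by (intro continuous_on_rabs continuous_on_diff k_joint
        continuous_on_compose2[OF kp[OF p, of UNIV]] continuous_intros) auto
  then have "continuous_on (S \<times> UNIV) (\<lambda>q. integral (cbox 0 (2 * pi)) (\<lambda>z. \<bar>?k q z - ?k p z\<bar>))"
    by (intro integral_continuous_on_param) (simp add: split_def)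
  then have "continuous_on (S \<times> UNIV) N"
    by (simp add: N_def cbox_interval)
  then have "(N \<longlongrightarrow> N p) (at p within S \<times> UNIV)"
    using p unfolding continuous_on_def by blast
  then have "((\<lambda>q. M * N q) \<longlongrightarrow> M * N p) (at p within S \<times> UNIV)"
    by (intro tendsto_intros)
  then have lim: "((\<lambda>q. M * N q) \<longlongrightarrow> 0) (at p within S \<times> UNIV)"
    by (simp add: N_def)
  have v: "?v q = integral {0..2 * pi} (\<lambda>z. K z * ?k q z)" if "q \<in> S \<times> UNIV" for q
    using that by (intro velocity_eq(1)[OF \<phi>] f(2) continuous_on_slice[OF f(1)]) auto
  have "norm (?v q - ?v p) \<le> M * N q" if q: "q \<in> S \<times> UNIV" for q
  proof -
    have i: "(\<lambda>z. K z * ?k r z) integrable_on {0..2 * pi}" if "r \<in> S \<times> UNIV" for r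
      using set_integrable_mult_continuous[OF K_integrable kp[OF that]]
      by (rule set_lebesgue_integral_eq_integral(1))
    have "?v q - ?v p = integral {0..2 * pi} (\<lambda>z. K z * ?k q z - K z * ?k p z)"
      unfolding v[OF q] v[OF p] by (rule integral_diff[OF i[OF q] i[OF p], symmetric])
    also have "\<dots> = integral {0..2 * pi} (\<lambda>z. K z * (?k q z - ?k p z))"
      by (simp add: right_diff_distrib)
    finally show ?thesis
      unfolding N_def real_norm_def
      using kernel_integral_bound[OF continuous_on_diff[OF kp[OF q] kp[OF p]], of 0 "2 * pi"] by simp
  qed
  then have "\<forall>\<^sub>F q in at p within S \<times> UNIV. norm (?v q - ?v p) \<le> M * N q"
    by (auto simp: eventually_at_filter)
  from Lim_null_comparison[OF this lim] have "(?v \<longlongrightarrow> ?v p) (at p within S \<times> UNIV)"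
    by (simp add: LIM_zero_iff)
  then show "((\<lambda>(t, x). velocity \<phi> (f t) x) \<longlongrightarrow> (\<lambda>(t, x). velocity \<phi> (f t) x) p) (at p within S \<times> UNIV)"
    by (simp add: split_def)
qed

lemma velocity_circle_fun:
  assumes "\<And>x y. \<phi> x y = K (x - y)"
  shows "circle_fun (velocity \<phi> \<rho>)"
  unfolding circle_fun_def
proof
  fix x
  have "K (x + 2 * pi - y) = K (x - y)" for y
    using circle_fun_int[OF K_per, of "x - y" 1] by (simp add: algebra_simps)
  then show "velocity \<phi> \<rho> (x + 2 * pi) = velocity \<phi> \<rho> x"
    by (simp add: velocity_def assms)
qed

end

lemma circle_fun_bounded:
  fixes u :: "real \<Rightarrow> real \<Rightarrow> real"
  assumes u: "continuous_on ({0..T} \<times> UNIV) (\<lambda>(t, x). u t x)" "\<And>t. t \<in> {0..T} \<Longrightarrow> circle_fun (u t)"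
  shows "\<exists>B. \<forall>t\<in>{0..T}. \<forall>x. \<bar>u t x\<bar> \<le> B"
proof -
  have "continuous_on ({0..T} \<times> {0..2 * pi}) (\<lambda>(t, x). u t x)"
    by (rule continuous_on_subset[OF u(1)]) auto
  then have "compact ((\<lambda>(t, x). u t x) ` ({0..T} \<times> {0..2 * pi}))"
    by (intro compact_continuous_image compact_Times compact_Icc)
  then obtain B where B: "\<forall>z\<in>{0..T} \<times> {0..2 * pi}. norm ((\<lambda>(t, x). u t x) z) \<le> B"
    using compact_imp_bounded bounded_iff by (metis (no_types, lifting) image_eqI)
  have "\<bar>u t x\<bar> \<le> B" if "t \<in> {0..T}" for t x
  proof -
    obtain y n where y: "y \<in> {0..<2 * pi}" "x = y + 2 * pi * of_int n"
      by (rule period_representative)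
    then have "u t x = u t y"
      using circle_fun_int[OF u(2)[OF that]] by simp
    then show ?thesis
      using bspec[OF B, of "(t, y)"] that y(1) by simp
  qed
  then show ?thesis by blast
qed

section \<open>Quantiles\<close>

lemma AE_pos_imp_pos_in_box:
  fixes f :: "real \<Rightarrow> real \<Rightarrow> real"
  assumes pos: "AE z in lebesgue_on ({0..T} \<times> UNIV). f (fst z) (snd z) > 0"
    and box: "0 \<le> t1" "t1 < t2" "t2 \<le> T" "x1 < x2"
  shows "\<exists>t\<in>{t1..t2}. \<exists>x\<in>{x1..x2}. f t x > 0"
proof (rule ccontr)
  assume neg: "\<not> ?thesis"
  have "({0..T} \<times> (UNIV :: real set)) \<inter> space lebesgue \<in> sets lebesgue"
    using closed_Times[of "{0..T}" "UNIV :: real set"] by auto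
  from pos[unfolded AE_restrict_space_iff[OF this]]
  obtain N where N: "N \<in> null_sets lebesgue"
    "{z \<in> space lebesgue. \<not> (z \<in> {0..T} \<times> UNIV \<longrightarrow> f (fst z) (snd z) > 0)} \<subseteq> N"
    unfolding eventually_ae_filter by blast
  have "cbox (t1, x1) (t2, x2) \<subseteq> N"
  proof
    fix z assume "z \<in> cbox (t1, x1) (t2, x2)"
    then have z: "fst z \<in> {t1..t2}" "snd z \<in> {x1..x2}"
      by (auto simp: cbox_Pair_eq)
    then have "\<not> f (fst z) (snd z) > 0"
      using neg by blast
    moreover have "z \<in> {0..T} \<times> UNIV"
      using z(1) box by (cases z) auto
    ultimately show "z \<in> N"
      using N(2) by auto
  qed
  then have "negligible (cbox (t1, x1) (t2, x2))"
    using N(1) negligible_subset negligible_iff_null_sets by blast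
  moreover have "box (t1, x1) (t2, x2) \<noteq> {}"
    using box by (auto simp: box_ne_empty Basis_prod_def)
  ultimately show False
    by (simp add: negligible_interval)
qed

lemma AE_lebesgue_on_Icc_ex:
  assumes "AE t in lebesgue_on {a..b::real}. P t" "a < b"
  shows "\<exists>t\<in>{a..b}. P t"
proof (rule ccontr)
  assume neg: "\<not> ?thesis"
  obtain N where N: "N \<in> null_sets lebesgue" "{t \<in> space lebesgue. \<not> (t \<in> {a..b} \<longrightarrow> P t)} \<subseteq> N"
    using assms(1)[unfolded AE_lebesgue_on_Icc] unfolding eventually_ae_filter by blast
  then have "{a..b} \<subseteq> N"
    using neg by auto
  then have "negligible {a..b}"
    using N(1) negligible_subset negligible_iff_null_sets by blast
  then show False
    using assms(2) negligible_interval(1)[of a b] by (simp add: box_real)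
qed

text \<open>The integral defining \<open>C\<close> is oriented, since \<open>t\<close> may precede
  \<open>a\<close>. As a difference of integrals from 0 it can be differentiated in \<open>t\<close>
  without distinguishing the two orders.\<close>

lemma interval_LINT_continuous:
  fixes g :: "real \<Rightarrow> real"
  assumes g: "continuous_on {0..T} g" and at: "a \<in> {0..T}" "t \<in> {0..T}"
  shows "(LINT s=a..t|lebesgue. g s) = integral {0..t} g - integral {0..a} g"
proof -
  have open_int: "(LINT s:{c<..<d}|lebesgue. g s) = integral {0..d} g - integral {0..c} g"
    if "c \<le> d" "c \<in> {0..T}" "d \<in> {0..T}" for c d
  proof -
    have cd: "continuous_on {c..d} g" and d: "continuous_on {0..d} g"
      using that by (auto intro: continuous_on_subset[OF g])
    have "set_integrable lebesgue {c<..<d} g"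
      by (rule set_integrable_subset[OF absolutely_integrable_continuous_real[OF cd]]) auto
    then have "(LINT s:{c<..<d}|lebesgue. g s) = integral {c..d} g"
      by (simp add: set_lebesgue_integral_eq_integral(2) integral_open_interval_real)
    also have "\<dots> = integral {0..d} g - integral {0..c} g"
      using Henstock_Kurzweil_Integration.integral_combine[of 0 c d g] that
        integrable_continuous_real[OF d] by simp
    finally show ?thesis .
  qed
  show ?thesis
    unfolding interval_lebesgue_integral_def
    using open_int[of a t] open_int[of t a] at by (auto simp: einterval_eq)
qed

lemma IVT_half_open:
  fixes F :: "real \<Rightarrow> real"
  assumes "\<And>x. isCont F x" "F a \<le> c" "c < F b" "a \<le> b"
  obtains y where "y \<in> {a..<b}" "F y = c"
proof -
  obtain y where "a \<le> y" "y \<le> b" "F y = c"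
    using IVT[of F a c b] assms by auto
  then show ?thesis
    using assms(3) by (intro that[of y]) (auto simp: order_le_less)
qed

text \<open>Reduction modulo 1 discards the integer part of \<open>\<eta>\<close>; since
  \<open>F\<close> gains exactly 1 per period, the same number of full turns restores it.\<close>

lemma circ_cdf_inv_lift:
  assumes \<rho>: "circle_fun \<rho>" "continuous_on UNIV \<rho>"
    and F: "\<And>x. (F has_real_derivative \<rho> x) (at x)" "F 0 = 0" "F (2 * pi) = 1" "strict_mono F"
  shows "F (circ_cdf_inv \<rho> \<eta> + 2 * pi * of_int \<lfloor>\<eta>\<rfloor>) = \<eta>"
proof -
  have cdf: "circ_cdf \<rho> x = F x" if "x \<ge> 0" for x
  proof -
    have "circ_cdf \<rho> x = integral {0..x} \<rho>"
      unfolding circ_cdf_def by (rule LINT_continuous[OF continuous_on_subset[OF \<rho>(2)]]) simp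
    then show ?thesis
      using integral_unique[OF antiderivative_has_integral[OF F(1) that]] F(2) by simp
  qed
  have "isCont F x" for x
    using F(1) by (rule DERIV_isCont)
  then obtain y where y: "y \<in> {0..<2 * pi}" "F y = frac \<eta>"
    using IVT_half_open[of F 0 "frac \<eta>" "2 * pi"] F(2,3) by (auto simp: frac_lt_1)
  have "inj_on (circ_cdf \<rho>) {0..<2 * pi}"
    using strict_mono_eq[OF F(4)] by (auto intro!: inj_onI simp: cdf)
  then have inv: "circ_cdf_inv \<rho> \<eta> = y"
    unfolding circ_cdf_inv_def using y by (intro the_inv_into_f_eq) (auto simp: cdf)
  \<comment> \<open>Subtracting the mean growth makes \<open>F\<close> periodic, so shifts by any
    integer number of periods are covered at once.\<close>
  have "circle_fun (\<lambda>x. F x - x / (2 * pi))"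
    using primitive_shift_period[OF \<rho>(1) F(1)] F(2,3)
    by (simp add: circle_fun_def add_divide_distrib)
  from circle_fun_int[OF this, of y "\<lfloor>\<eta>\<rfloor>"]
  have "F (y + 2 * pi * of_int \<lfloor>\<eta>\<rfloor>) = F y + of_int \<lfloor>\<eta>\<rfloor>"
    by (simp add: add_divide_distrib)
  then show ?thesis
    by (simp add: inv y(2) frac_def)
qed

text \<open>\<open>H\<close> pushes the density on one period forward to Lebesgue measure on the
  unit interval. \<open>X\<close> inverts \<open>H\<close> only up to \<open>n z\<close> full turns,
  which a periodic kernel does not see. Starting the period at the zero \<open>p\<close> of
  \<open>H\<close> avoids splitting the interval where the argument wraps around.\<close>

lemma (in bounded_kernel) velocity_eq_quantile_integral:
  assumes \<phi>: "\<And>x y. \<phi> x y = K (x - y)"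
    and \<rho>: "continuous_on UNIV \<rho>" "circle_fun \<rho>" "\<And>y. \<rho> y \<ge> 0"
    and H: "\<And>y. (H has_real_derivative \<rho> y) (at y)" "strict_mono H" "H p = 0" "H (p + 2 * pi) = 1"
    and X: "\<And>z. z \<in> {0..1} \<Longrightarrow> H (X z + 2 * pi * of_int (n z)) = z"
  shows "(LINT z:{0..1}|lebesgue. \<phi> x (X z)) = velocity \<phi> \<rho> x"
proof -
  let ?S = "{p..p + 2 * pi}"
  have img: "H ` ?S = {0..1}"
  proof
    show "H ` ?S \<subseteq> {0..1}"
      using strict_mono_less_eq[OF H(2)] H(3,4) by (metis atLeastAtMost_iff image_subsetI)
    show "{0..1} \<subseteq> H ` ?S"
    proof
      fix z :: real assume z: "z \<in> {0..1}"
      let ?y = "X z + 2 * pi * of_int (n z)"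
      have "H p \<le> H ?y" "H ?y \<le> H (p + 2 * pi)"
        using X[OF z] H(3,4) z by auto
      then have "?y \<in> ?S"
        by (simp add: strict_mono_less_eq[OF H(2)])
      then show "z \<in> H ` ?S"
        using X[OF z] by (intro image_eqI[of _ _ ?y]) auto
    qed
  qed
  have K_X: "K (x - X (H y)) = K (x - y)" if "y \<in> ?S" for y
  proof -
    have "H y \<in> {0..1}"
      using img that by blast
    from X[OF this] have "X (H y) + 2 * pi * of_int (n (H y)) = y"
      using strict_mono_eq[OF H(2)] by blast
    then have "x - X (H y) = (x - y) + 2 * pi * of_int (n (H y))"
      by linarith
    then show ?thesis
      by (simp only: circle_fun_int[OF K_per])
  qed
  let ?I = "velocity \<phi> \<rho> x"
  \<comment> \<open>This substitution formula asks for injectivity of \<open>H\<close> only, so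
    zeros of its derivative \<open>\<rho>\<close> do no harm.\<close>
  have "((\<lambda>y. \<bar>\<rho> y\<bar> * K (x - X (H y))) absolutely_integrable_on ?S \<and>
      integral ?S (\<lambda>y. \<bar>\<rho> y\<bar> * K (x - X (H y))) = ?I) \<longleftrightarrow>
    ((\<lambda>z. K (x - X z)) absolutely_integrable_on (H ` ?S) \<and> integral (H ` ?S) (\<lambda>z. K (x - X z)) = ?I)"
    by (rule has_absolute_integral_change_of_variables_1')
      (auto intro: has_field_derivative_at_within[OF H(1)] inj_on_subset[OF strict_mono_imp_inj_on[OF H(2)]])
  moreover have "(\<lambda>y. \<bar>\<rho> y\<bar> * K (x - X (H y))) absolutely_integrable_on ?S \<longleftrightarrow>
      (\<lambda>y. K (x - y) * \<rho> y) absolutely_integrable_on ?S"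
    by (rule set_integrable_cong) (use K_X \<rho>(3) in \<open>auto simp: mult.commute\<close>)
  moreover have "integral ?S (\<lambda>y. \<bar>\<rho> y\<bar> * K (x - X (H y))) = integral ?S (\<lambda>y. K (x - y) * \<rho> y)"
    by (rule integral_cong) (use K_X \<rho>(3) in \<open>auto simp: mult.commute\<close>)
  ultimately have "(\<lambda>z. K (x - X z)) absolutely_integrable_on {0..1}" "integral {0..1} (\<lambda>z. K (x - X z)) = ?I"
    using convolution_change_of_variables(1)[OF \<rho>(1)] velocity_eq(2)[where c = p, OF \<phi> \<rho>(1,2)]
    unfolding img by auto
  then show ?thesis
    by (simp add: \<phi> set_lebesgue_integral_eq_integral(2))
qed

theorem proposition2p4:
  fixes T a :: real and k :: nat
    and \<phi> :: "real \<Rightarrow> real \<Rightarrow> real" and f0 :: "real \<Rightarrow> real" and f :: "real \<Rightarrow> real \<Rightarrow> real"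
    and C :: "real \<Rightarrow> real" and xt :: "real \<Rightarrow> real \<Rightarrow> real"
  assumes "T > 0"
    and "initial_datum_assumption k f0"
    and "interaction_assumption \<phi>"
    and "is_solution T k \<phi> f0 f"
    and "AE z in lebesgue_on ({0..T} \<times> UNIV). f (fst z) (snd z) > 0"
    and "a \<in> {0..T}"
    and "\<forall>t\<in>{0..T}. C t =
           (LINT s=a..t|lebesgue. (f s 0 * (LINT y:{0..2 * pi}|lebesgue. \<phi> 0 y * f s y)))"
    and "\<forall>t\<in>{0..T}. \<forall>\<xi>\<in>{0..1}. xt t \<xi> = circ_cdf_inv (f t) (\<xi> + C t)"
  shows "AE t in lebesgue_on {0..T}. \<forall>\<xi>\<in>{0..1}.
           has_circle_derivative_within (\<lambda>s. xt s \<xi>)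
             (LINT z:{0..1}|lebesgue. \<phi> (xt t \<xi>) (xt t z)) t {0..T}"
proof -
  note T = assms(1) and a = assms(6)
  obtain K M where \<phi>: "\<And>x y. \<phi> x y = K (x - y)" and K: "circle_Linf K"
    and M: "AE x in lebesgue. \<bar>K x\<bar> \<le> M"
    using assms(3) by (auto simp: interaction_assumption_def circle_Linf_def)
  interpret bounded_kernel K M
    using K M by unfold_locales (auto simp: circle_Linf_def)
  obtain f' where f_per: "\<And>t. t \<in> {0..T} \<Longrightarrow> circle_fun (f t)"
    and f_cont: "continuous_on ({0..T} \<times> UNIV) (\<lambda>(t, x). f t x)"
    and f_mass: "AE t in lebesgue_on {0..T}. (LINT x:{0..2 * pi}|lebesgue. \<bar>f t x\<bar>) = 1"
    and f': "Linf_sobolev T (k - 1) 2 f'" "weak_time_deriv T f f'"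
    and eq: "AE t in lebesgue_on {0..T}.
      circle_weak_deriv 1 (\<lambda>x. f t x * velocity \<phi> (f t) x) (\<lambda>x. - f' t x)"
    using assms(4) unfolding is_solution_def by blast
  define u where "u = (\<lambda>t. velocity \<phi> (f t))"
  define J where "J = (\<lambda>t x. f t x * u t x)"
  have u_cont: "continuous_on ({0..T} \<times> UNIV) (\<lambda>(t, x). u t x)"
    unfolding u_def by (rule velocity_continuous[OF \<phi> f_cont f_per])
  have u_per: "circle_fun (u t)" for t
    unfolding u_def by (rule velocity_circle_fun[OF \<phi>])
  have J_cont: "continuous_on ({0..T} \<times> UNIV) (\<lambda>(t, x). J t x)"
    using continuous_on_mult[OF f_cont u_cont] by (simp add: J_def split_def)
  have J_per: "circle_fun (J t)" if "t \<in> {0..T}" for t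
    using f_per[OF that] u_per[of t] by (simp add: circle_fun_def J_def)
  have f_cont': "continuous_on UNIV (f t)" if "t \<in> {0..T}" for t
    by (rule continuous_on_slice[OF f_cont that])
  have "\<forall>t\<in>{0..T}. \<exists>F. (\<forall>x. (F has_real_derivative f t x) (at x)) \<and> F 0 = 0"
    using ex_antiderivative[OF f_cont'] by blast
  then obtain F where F: "\<And>t x. t \<in> {0..T} \<Longrightarrow> (F t has_real_derivative f t x) (at x)"
    and F0: "\<And>t. t \<in> {0..T} \<Longrightarrow> F t 0 = 0"
    by metis
  have evolution: "F t (2 * pi) = F 0 (2 * pi)"
      "F t x - F 0 x = integral {0..t} (\<lambda>s. J s 0) - integral {0..t} (\<lambda>s. J s x)"
    if "t \<in> {0..T}" for t x
    using cdf_evolution[OF T f_cont f_per J_cont J_per f' _ F F0 that] eq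
    by (auto simp: J_def u_def)
  have J_cont': "continuous_on {0..T} (\<lambda>s. J s x)" for x
    by (rule continuous_on_slice'[OF J_cont])
  define c0 where "c0 = integral {0..a} (\<lambda>s. J s 0)"
  have C: "C t = integral {0..t} (\<lambda>s. J s 0) - c0" if t: "t \<in> {0..T}" for t
    using assms(7) t interval_LINT_continuous[OF J_cont' a t]
    by (simp add: J_def u_def velocity_def c0_def)
  define G where "G = (\<lambda>t x. F t x - C t)"
  \<comment> \<open>The fluxes through 0 coming from \<open>F\<close> and from \<open>C\<close>
    cancel up to the constant \<open>c0\<close>. Time then enters only through an integral at fixed
    \<open>x\<close>, which is differentiable in \<open>t\<close>.\<close>
  have G_eq: "G t x = F 0 x + c0 - integral {0..t} (\<lambda>s. J s x)" if "t \<in> {0..T}" for t x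
    using evolution(2)[OF that, of x] C[OF that] by (simp add: G_def)
  have G_t: "((\<lambda>s. G s x) has_real_derivative - (f t x * u t x)) (at t within {0..T})"
    if t: "t \<in> {0..T}" for t x
  proof -
    have "((\<lambda>s. F 0 x + c0 - integral {0..s} (\<lambda>s. J s x)) has_real_derivative 0 - J t x)
        (at t within {0..T})"
      by (intro DERIV_diff DERIV_const integral_has_real_derivative J_cont' t)
    then have "((\<lambda>s. G s x) has_real_derivative 0 - J t x) (at t within {0..T})"
      by (rule has_field_derivative_transform_within[of _ _ _ _ 1]) (use G_eq t in auto)
    then show ?thesis
      by (simp add: J_def)
  qed
  interpret transport_potential T f u G
  proof
    show "\<exists>B. \<forall>t\<in>{0..T}. \<forall>x. \<bar>u t x\<bar> \<le> B"
      by (rule circle_fun_bounded[OF u_cont u_per])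
    show "(G t has_real_derivative f t x) (at x)" if "t \<in> {0..T}" for t x
      using DERIV_diff[OF F[OF that] DERIV_const] by (simp add: G_def)
  qed (use T f_cont u_cont G_t AE_pos_imp_pos_in_box[OF assms(5)] in blast)+
  have mass: "F t (2 * pi) = 1" if "t \<in> {0..T}" for t
  proof -
    \<comment> \<open>Unit mass is given at almost every time; a single such time suffices, because
      the mass is the same at all times.\<close>
    obtain s where s: "s \<in> {0..T}" "(LINT x:{0..2 * pi}|lebesgue. \<bar>f s x\<bar>) = 1"
      using AE_lebesgue_on_Icc_ex[OF f_mass T] by blast
    have "(LINT x:{0..2 * pi}|lebesgue. \<bar>f s x\<bar>) = integral {0..2 * pi} (f s)"
      using LINT_continuous[OF continuous_on_subset[OF f_cont'[OF s(1)]]] f_nonneg[OF s(1)] by simp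
    moreover have "(f s has_integral F s (2 * pi)) {0..2 * pi}"
      using antiderivative_has_integral[OF F[OF s(1)], of 0 "2 * pi"] F0[OF s(1)] by simp
    ultimately show ?thesis
      using s(2) evolution(1)[OF that] evolution(1)[OF s(1)] by (simp add: integral_unique)
  qed
  have F_mono: "strict_mono (F t)" if "t \<in> {0..T}" for t
    using G_strict_mono[OF that] by (intro strict_monoI) (simp add: G_def)
  \<comment> \<open>The floor compensates the jumps of the representative in
    \<open>[0, 2 * pi)\<close>, so this is the lift required by
    \<open>has_circle_derivative_within\<close>.\<close>
  define lift where "lift = (\<lambda>\<xi> s. xt s \<xi> + 2 * pi * of_int \<lfloor>\<xi> + C s\<rfloor>)"
  have lift: "G s (lift \<xi> s) = \<xi>" if "s \<in> {0..T}" "\<xi> \<in> {0..1}" for s \<xi>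
    using circ_cdf_inv_lift[OF f_per f_cont' F F0 mass F_mono, of s "\<xi> + C s"] that assms(8)
    by (simp add: G_def lift_def)
  have velocity: "(LINT z:{0..1}|lebesgue. \<phi> (xt t \<xi>) (xt t z)) = u t (lift \<xi> t)"
    if t: "t \<in> {0..T}" for t \<xi>
  proof -
    have "(LINT z:{0..1}|lebesgue. \<phi> (xt t \<xi>) (xt t z)) = u t (xt t \<xi>)"
      unfolding u_def
    proof (rule velocity_eq_quantile_integral[OF \<phi> f_cont'[OF t] f_per[OF t] f_nonneg[OF t] G_x[OF t]])
      show "strict_mono (G t)"
        using G_strict_mono[OF t] by (intro strict_monoI)
      \<comment> \<open>The quantile of 0 starts the period on which \<open>G t\<close> runs from 0
        to 1.\<close>
      show "G t (lift 0 t) = 0"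
        using lift[OF t, of 0] by simp
      then show "G t (lift 0 t + 2 * pi) = 1"
        using primitive_shift_period[OF f_per[OF t] F[OF t]] mass[OF t] F0[OF t] by (simp add: G_def)
      show "G t (xt t z + 2 * pi * of_int \<lfloor>z + C t\<rfloor>) = z" if "z \<in> {0..1}" for z
        using lift[OF t that] by (simp add: lift_def)
    qed
    then show ?thesis
      by (simp add: lift_def circle_fun_int[OF u_per])
  qed
  have "has_circle_derivative_within (\<lambda>s. xt s \<xi>) (LINT z:{0..1}|lebesgue. \<phi> (xt t \<xi>) (xt t z)) t {0..T}"
    if t: "t \<in> {0..T}" and \<xi>: "\<xi> \<in> {0..1}" for t \<xi>
    unfolding has_circle_derivative_within_def velocity[OF t]
    by (rule exI[of _ "lift \<xi>"])
      (use level_curve_derivative[OF lift[OF _ \<xi>] t] in \<open>auto simp: lift_def\<close>)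
  \<comment> \<open>The derivative has been found at every time of the interval, which is
    specialised to almost every time.\<close>
  then show ?thesis
    by (intro AE_I2) (simp add: space_restrict_space)
qed

end
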